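(* Let $\pi$ be a representation of the Cuntz algebra $\mathcal{O}_n$ on a Hilbert space $\mathcal{L}$ and $\underline{W}=(\pi(s_1),\ldots,\pi(s_n))$. Then: (i) $\pi$ decomposes uniquely as $\pi=\pi^0\oplus\pi^1$ (with respect to an orthogonal decomposition of $\mathcal{L}$ into reducing subspaces), where $\pi^0$ is spherical and $(\pi^1(s_1),\ldots,\pi^1(s_n))$ has trivial maximal commuting piece (either summand may be absent); (ii) the maximal commuting piece of $\underline{W}$ is either trivial or a spherical unitary; (iii) if $\pi$ is irreducible, then either the maximal commuting piece of $\underline{W}$ is trivial or it acts on a one-dimensional space, and in the latter case $\pi$ is unitarily equivalent to the GNS representation of a Cuntz state.
   Context: $\mathcal{O}_n$ ($n\ge2$): the $C^*$-algebra generated by isometries $s_1,\ldots,s_n$ with $s_i^*s_j=\delta_{ij}I$, $\sum s_is_i^*=I$. Words: $\tilde\Lambda$ the finite words over $\{1,\ldots,n\}$ including the empty word, $\underline{W}^\alpha=W_{\alpha_1}\cdots W_{\alpha_m}$. Maximal commuting piece of a tuple $\underline{W}$ on $\mathcal{L}$: let $\mathcal{L}^c(\underline{W})$ be the largest closed subspace invariant under every $W_i^*$ such that $W_i^*W_j^*h=W_j^*W_i^*h$ for all $h$ in it and all $i,j$; the piece is $W_i^c=P_{\mathcal{L}^c}W_i|_{\mathcal{L}^c}$, and it is trivial if $\mathcal{L}^c(\underline{W})=\{0\}$. A spherical unitary is a commuting tuple of normal operators $\underline{Z}$ with $\sum Z_iZ_i^*=I$. $\pi$ is spherical if $\overline{\mathrm{span}}\{\underline{W}^\alpha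 h:h\in\mathcal{L}^c(\underline{W}),\alpha\in\tilde\Lambda\}=\mathcal{L}$. For $w\in\partial B_n=\{w\in\mathbb{C}^n:\sum|w_i|^2=1\}$, the Cuntz state is the state on $\mathcal{O}_n$ given by $s_{i_1}\cdots s_{i_m}s_{j_1}^*\cdots s_{j_p}^*\mapsto w_{i_1}\cdots w_{i_m}\overline{w_{j_1}}\cdots\overline{w_{j_p}}$. *)

theory Defs
  imports "HOL-Analysis.Analysis"
begin

text \<open>A complex Hilbert space is modelled as a real Hilbert space (real inner product
  = real part of the complex inner product, complete) together with a complex structure
  imult (multiplication by the imaginary unit), which is real-linear, squares to minus the
  identity and preserves the real inner product.\<close>

class chilbert = real_inner + complete_space +
  fixes imult :: "'a \<Rightarrow> 'a"
  assumes imult_add: "imult (x + y) = imult x + imult y"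
    and imult_scaleR: "imult (r *\<^sub>R x) = r *\<^sub>R imult x"
    and imult_imult: "imult (imult x) = - x"
    and imult_inner: "inner (imult x) (imult y) = inner x y"

definition scaleC :: "complex \<Rightarrow> 'a::chilbert \<Rightarrow> 'a" where
  "scaleC c x = Re c *\<^sub>R x + Im c *\<^sub>R imult x"

text \<open>Complex inner product, linear in the first argument.\<close>
definition cinner :: "'a::chilbert \<Rightarrow> 'a \<Rightarrow> complex" where
  "cinner x y = Complex (inner x y) (- inner (imult x) y)"

definition clinear_op :: "('a::chilbert \<Rightarrow> 'a) \<Rightarrow> bool" where
  "clinear_op T \<longleftrightarrow> bounded_linear T \<and> (\<forall>x. T (imult x) = imult (T x))"

definition csubspace :: "'a::chilbert set \<Rightarrow> bool" where
  "csubspace M \<longleftrightarrow> subspace M \<and> imult ` M \<subseteq> M"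

definition closed_csubspace :: "'a::chilbert set \<Rightarrow> bool" where
  "closed_csubspace M \<longleftrightarrow> csubspace M \<and> closed M"

definition cspan :: "'a::chilbert set \<Rightarrow> 'a set" where
  "cspan S = span (S \<union> imult ` S)"

definition oproj :: "'a::chilbert set \<Rightarrow> 'a \<Rightarrow> 'a" where
  "oproj M x = (THE y. y \<in> M \<and> (\<forall>z\<in>M. inner (x - y) z = 0))"

definition sub_adjoint :: "'a::chilbert set \<Rightarrow> ('a \<Rightarrow> 'a) \<Rightarrow> 'a \<Rightarrow> 'a" where
  "sub_adjoint K T = (SOME S. (\<forall>x\<in>K. S x \<in> K) \<and>
      (\<forall>x\<in>K. \<forall>y\<in>K. inner (T x) y = inner x (S y)))"

text \<open>A representation of O_n on the Hilbert space is the same as the n-tuple of images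
  W i = pi(s_(i+1)), i < n, satisfying the Cuntz relations (universal property of O_n).\<close>
definition cuntz_family :: "nat \<Rightarrow> (nat \<Rightarrow> 'a::chilbert \<Rightarrow> 'a) \<Rightarrow> bool" where
  "cuntz_family n W \<longleftrightarrow>
     (\<forall>i<n. clinear_op (W i)) \<and>
     (\<forall>i<n. \<forall>j<n. \<forall>x. adjoint (W i) (W j x) = (if i = j then x else 0)) \<and>
     (\<forall>x. (\<Sum>i<n. W i (adjoint (W i) x)) = x)"

primrec word :: "(nat \<Rightarrow> 'a \<Rightarrow> 'a) \<Rightarrow> nat list \<Rightarrow> 'a \<Rightarrow> 'a" where
  "word W [] = id"
| "word W (i # \<alpha>) = W i \<circ> word W \<alpha>"

definition reducing :: "nat \<Rightarrow> (nat \<Rightarrow> 'a::chilbert \<Rightarrow> 'a) \<Rightarrow> 'a set \<Rightarrow> bool" where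
  "reducing n W K \<longleftrightarrow> closed_csubspace K \<and>
     (\<forall>i<n. W i ` K \<subseteq> K \<and> adjoint (W i) ` K \<subseteq> K)"

definition comm_inv :: "nat \<Rightarrow> (nat \<Rightarrow> 'a::chilbert \<Rightarrow> 'a) \<Rightarrow> 'a set \<Rightarrow> 'a set \<Rightarrow> bool" where
  "comm_inv n W K M \<longleftrightarrow> closed_csubspace M \<and> M \<subseteq> K \<and>
     (\<forall>i<n. sub_adjoint K (W i) ` M \<subseteq> M) \<and>
     (\<forall>i<n. \<forall>j<n. \<forall>h\<in>M. sub_adjoint K (W i) (sub_adjoint K (W j) h)
                        = sub_adjoint K (W j) (sub_adjoint K (W i) h))"

definition comm_space :: "nat \<Rightarrow> (nat \<Rightarrow> 'a::chilbert \<Rightarrow> 'a) \<Rightarrow> 'a set \<Rightarrow> 'a set" where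
  "comm_space n W K = (GREATEST M. comm_inv n W K M)"

definition max_comm_piece :: "nat \<Rightarrow> (nat \<Rightarrow> 'a::chilbert \<Rightarrow> 'a) \<Rightarrow> 'a set \<Rightarrow> nat \<Rightarrow> 'a \<Rightarrow> 'a" where
  "max_comm_piece n W K i x = oproj (comm_space n W K) (W i x)"

definition trivial_comm :: "nat \<Rightarrow> (nat \<Rightarrow> 'a::chilbert \<Rightarrow> 'a) \<Rightarrow> 'a set \<Rightarrow> bool" where
  "trivial_comm n W K \<longleftrightarrow> comm_space n W K = {0}"

definition spherical :: "nat \<Rightarrow> (nat \<Rightarrow> 'a::chilbert \<Rightarrow> 'a) \<Rightarrow> 'a set \<Rightarrow> bool" where
  "spherical n W K \<longleftrightarrow>
     closure (cspan {word W \<alpha> h | \<alpha> h. set \<alpha> \<subseteq> {..<n} \<and> h \<in> comm_space n W K}) = K"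

definition spherical_unitary_on :: "nat \<Rightarrow> 'a::chilbert set \<Rightarrow> (nat \<Rightarrow> 'a \<Rightarrow> 'a) \<Rightarrow> bool" where
  "spherical_unitary_on n M Z \<longleftrightarrow>
     (\<forall>i<n. \<forall>x\<in>M. Z i x \<in> M) \<and>
     (\<forall>i<n. \<forall>j<n. \<forall>x\<in>M. Z i (Z j x) = Z j (Z i x)) \<and>
     (\<forall>i<n. \<forall>x\<in>M. Z i (sub_adjoint M (Z i) x) = sub_adjoint M (Z i) (Z i x)) \<and>
     (\<forall>x\<in>M. (\<Sum>i<n. Z i (sub_adjoint M (Z i) x)) = x)"

definition irreducible_rep :: "nat \<Rightarrow> (nat \<Rightarrow> 'a::chilbert \<Rightarrow> 'a) \<Rightarrow> bool" where
  "irreducible_rep n W \<longleftrightarrow> (\<forall>K. reducing n W K \<longrightarrow> K = {0} \<or> K = UNIV)"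

definition one_dim :: "'a::chilbert set \<Rightarrow> bool" where
  "one_dim M \<longleftrightarrow> (\<exists>v. v \<noteq> 0 \<and> M = range (\<lambda>c. scaleC c v))"

text \<open>The representation is unitarily equivalent to the GNS representation of the Cuntz
  state at w: by the uniqueness part of the GNS construction this means there is a unit
  cyclic vector xi with <pi(a) xi, xi> = phi_w(a); it suffices (and is necessary) to test this
  on the monomials s^alpha s^beta*, which span a dense *-subalgebra of O_n.\<close>
definition cuntz_gns_equiv :: "nat \<Rightarrow> (nat \<Rightarrow> 'a::chilbert \<Rightarrow> 'a) \<Rightarrow> (nat \<Rightarrow> complex) \<Rightarrow> bool" where
  "cuntz_gns_equiv n W w \<longleftrightarrow> (\<exists>\<xi>. norm \<xi> = 1 \<and>
     closure (cspan {word W \<alpha> (word (\<lambda>i. adjoint (W i)) \<beta> \<xi>) | \<alpha> \<beta>.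
                       set \<alpha> \<subseteq> {..<n} \<and> set \<beta> \<subseteq> {..<n}}) = UNIV \<and>
     (\<forall>\<alpha> \<beta>. set \<alpha> \<subseteq> {..<n} \<longrightarrow> set \<beta> \<subseteq> {..<n} \<longrightarrow>
        cinner (word W \<alpha> (word (\<lambda>i. adjoint (W i)) \<beta> \<xi>)) \<xi>
          = prod_list (map w \<alpha>) * cnj (prod_list (map w \<beta>))))"

end

theory Submission
  imports Defs
begin

text \<open>
  Write \<open>A i\<close> for the adjoint of \<open>W i\<close> and \<open>L\<close> for the space of the maximal commuting piece.
  The maximal commuting piece of the restriction to a reducing subspace \<open>K\<close> lives on \<open>L \<inter> K\<close>, so the
  spherical summand has to be the reducing subspace generated by \<open>L\<close>.

  On \<open>L\<close> the operators \<open>A i\<close> only form a commuting spherical isometry; normality comes from the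
  maximality of \<open>L\<close>. For \<open>h\<close> in \<open>L\<close> let \<open>v k\<close> be the sum of \<open>W\<^sup>\<alpha> W\<^sub>i (W\<^sup>\<alpha>)\<^sup>* h\<close> over the words \<open>\<alpha>\<close> of
  length \<open>k\<close>. Commutativity gives the Gram matrix of this sequence: the diagonal entries are the
  squared norm of \<open>h\<close> and all the others the squared norm of \<open>A i h\<close>. Hence the Cesaro means
  converge, to \<open>u\<^sub>i h\<close> say. As \<open>A j\<close> acts on the sequence as a shift, \<open>A j (u\<^sub>i h) = u\<^sub>i (A j h)\<close>,
  so the vector \<open>u\<^sub>i h\<close> lies in \<open>L\<close> by maximality. It is therefore the projection of \<open>W i h\<close> onto \<open>L\<close>,
  and the compressions of the \<open>W i\<close> commute with the \<open>A j\<close>.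

  If the representation is irreducible, \<open>L\<close> has no nontrivial closed subspace invariant under these
  commuting normal operators, as it would generate a proper reducing subspace. For a self-adjoint operator
  \<open>T\<close> commuting with all of them this forces one factor of \<open>(\<bar>T - m\<bar> + (T - m)) (\<bar>T - m\<bar> - (T - m)) = 0\<close>
  to vanish for every real \<open>m\<close>, so \<open>T\<close> is a scalar and \<open>L\<close> is a line.
\<close>

instance chilbert \<subseteq> banach ..

section \<open>Real Hilbert spaces\<close>

text \<open>A minimising sequence for the distance from \<open>x\<close> to \<open>M\<close> is
  Cauchy by the parallelogram law, and its limit \<open>y\<close> attains the distance. The
  variational inequality for a closest point, read at \<open>y + z\<close> and at
  \<open>y - z\<close>, then gives orthogonality.\<close>

lemma orthogonal_projection_exists:
  fixes M :: "'a::{real_inner,banach} set"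
  assumes M: "subspace M" "closed M"
  obtains y where "y \<in> M" "\<And>z. z \<in> M \<Longrightarrow> inner (x - y) z = 0"
proof -
  define d where "d = infdist x M"
  have ne: "M \<noteq> {}" using subspace_0[OF M(1)] by auto
  have d0: "d \<ge> 0" unfolding d_def by (rule infdist_nonneg)
  have lb: "d \<le> dist x z" if "z \<in> M" for z
    unfolding d_def using that by (rule infdist_le)
  have "\<exists>s\<in>M. (dist x s)\<^sup>2 < d\<^sup>2 + inverse (real (Suc k))" for k
  proof (rule ccontr)
    let ?r = "sqrt (d\<^sup>2 + inverse (real (Suc k)))"
    assume "\<not> ?thesis"
    then have "?r \<le> dist x s" if "s \<in> M" for s
      using that by (intro real_le_lsqrt) (auto simp: not_less)
    then have "?r \<le> infdist x M"
      using ne by (auto simp: infdist_def intro: cINF_greatest)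
    moreover have "d < ?r"
      by (rule real_less_rsqrt) simp
    ultimately show False by (simp add: d_def)
  qed
  then obtain s where s: "\<And>k. s k \<in> M" "\<And>k. (dist x (s k))\<^sup>2 < d\<^sup>2 + inverse (real (Suc k))"
    by metis
  \<comment> \<open>Parallelogram law, with the midpoint of \<open>a\<close> and \<open>b\<close> as
    a competitor in \<open>M\<close>.\<close>
  have par: "(dist a b)\<^sup>2 \<le> 2 * (dist x a)\<^sup>2 + 2 * (dist x b)\<^sup>2 - 4 * d\<^sup>2"
    if "a \<in> M" "b \<in> M" for a b
  proof -
    have "(1/2) *\<^sub>R (a + b) \<in> M"
      using that M(1) by (simp add: subspace_add subspace_scale)
    from power_mono[OF lb[OF this] d0, of 2]
    have "4 * d\<^sup>2 \<le> 4 * (dist x ((1/2) *\<^sub>R (a + b)))\<^sup>2" by simp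
    also have "\<dots> = 2 * (dist x a)\<^sup>2 + 2 * (dist x b)\<^sup>2 - (dist a b)\<^sup>2"
      by (simp add: dist_norm power2_norm_eq_inner inner_diff inner_add inner_commute algebra_simps)
    finally show ?thesis by simp
  qed
  have "Cauchy s"
  proof (rule metric_CauchyI)
    fix e :: real assume "e > 0"
    then obtain N where N: "inverse (real (Suc N)) < e\<^sup>2 / 4"
      using reals_Archimedean[of "e\<^sup>2 / 4"] by auto
    have "dist (s k) (s l) < e" if "k \<ge> N" "l \<ge> N" for k l
    proof -
      have "inverse (real (Suc k)) \<le> inverse (real (Suc N))" "inverse (real (Suc l)) \<le> inverse (real (Suc N))"
        using that by (auto intro!: le_imp_inverse_le)
      then have "(dist (s k) (s l))\<^sup>2 < e\<^sup>2"
        using par[OF s(1)[of k] s(1)[of l]] s(2)[of k] s(2)[of l] N by linarith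
      then show ?thesis using \<open>e > 0\<close> by (simp add: power_less_imp_less_base)
    qed
    then show "\<exists>N. \<forall>k\<ge>N. \<forall>l\<ge>N. dist (s k) (s l) < e" by blast
  qed
  then obtain y where y: "s \<longlonglongrightarrow> y" using Cauchy_convergent convergent_def by blast
  have yM: "y \<in> M" using closed_sequentially[OF M(2) s(1) y] .
  have "(\<lambda>k. (dist x (s k))\<^sup>2) \<longlonglongrightarrow> (dist x y)\<^sup>2"
    by (intro tendsto_intros y)
  moreover have "(\<lambda>k. d\<^sup>2 + inverse (real (Suc k))) \<longlonglongrightarrow> d\<^sup>2 + 0"
    by (intro tendsto_intros LIMSEQ_inverse_real_of_nat)
  ultimately have "(dist x y)\<^sup>2 \<le> d\<^sup>2 + 0"
    by (rule LIMSEQ_le) (use s(2) in \<open>auto intro: less_imp_le\<close>)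
  then have dy: "dist x y \<le> d" using d0 power2_le_imp_le by auto
  have le: "inner (x - y) (z - y) \<le> 0" if "z \<in> M" for z
    by (rule any_closest_point_dot[OF subspace_imp_convex[OF M(1)] M(2) yM that])
      (use dy lb in force)
  show ?thesis
  proof (rule that[OF yM])
    fix z assume z: "z \<in> M"
    show "inner (x - y) z = 0"
      using le[of "y + z"] le[of "y - z"] z yM M(1) by (simp add: subspace_add subspace_diff)
  qed
qed

lemma orthogonal_projection_unique:
  assumes "subspace M" "y \<in> M" "\<And>z. z \<in> M \<Longrightarrow> inner (x - y) z = 0"
    "y' \<in> M" "\<And>z. z \<in> M \<Longrightarrow> inner (x - y') z = 0"
  shows "y = y'"
proof -
  have "y - y' \<in> M" using assms by (simp add: subspace_diff)
  then have "inner (x - y') (y - y') - inner (x - y) (y - y') = 0" using assms by simp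
  then have "inner (y - y') (y - y') = 0" by (simp add: inner_diff_left)
  then show ?thesis by simp
qed

text \<open>\<open>adjoint\<close> is defined by choice, so some adjoint has to be exhibited first.
  It comes from Riesz representation: a nonzero functional \<open>inner (T x) y\<close> is
  represented by a multiple of a vector orthogonal to its kernel.\<close>

lemma adjoint_inner:
  fixes T :: "'a::{real_inner,banach} \<Rightarrow> 'a"
  assumes "bounded_linear T"
  shows "inner (T x) y = inner x (adjoint T y)"
proof -
  interpret T: bounded_linear T by fact
  have "\<exists>u. \<forall>x. inner (T x) y = inner x u" for y
  proof (cases "\<forall>x. inner (T x) y = 0")
    case True then show ?thesis by (intro exI[of _ 0]) simp
  next
    case False
    then obtain x0 where x0: "inner (T x0) y \<noteq> 0" by auto
    let ?M = "{x. inner (T x) y = 0}"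
    have M: "subspace ?M" "closed ?M"
      by (auto simp: subspace_def T.add T.scaleR inner_add_left
          intro!: closed_Collect_eq continuous_intros T.continuous_on)
    obtain m where m: "m \<in> ?M" "\<And>z. z \<in> ?M \<Longrightarrow> inner (x0 - m) z = 0"
      using orthogonal_projection_exists[OF M] by metis
    let ?z = "x0 - m"
    have z: "inner (T ?z) y \<noteq> 0" using x0 m(1) by (simp add: T.diff inner_diff_left)
    then have "?z \<noteq> 0" by (metis T.zero inner_zero_left)
    have "inner (T x) y = inner x ((inner (T ?z) y / inner ?z ?z) *\<^sub>R ?z)" for x
    proof -
      let ?c = "inner (T x) y / inner (T ?z) y"
      have "x - ?c *\<^sub>R ?z \<in> ?M"
        using z by (simp add: T.diff T.scaleR inner_diff_left)
      from m(2)[OF this] have "inner ?z x = ?c * inner ?z ?z"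
        by (simp add: inner_diff_right)
      moreover have "inner x (b *\<^sub>R ?z) = b * inner ?z x" for b
        by (simp add: inner_commute)
      ultimately show ?thesis using z \<open>?z \<noteq> 0\<close> by (simp del: inner_diff_left inner_diff_right)
    qed
    then show ?thesis by blast
  qed
  then obtain g where g: "\<And>x y. inner (T x) y = inner x (g y)" by metis
  then have "adjoint T = g" by (intro adjoint_unique) simp
  then show ?thesis using g by simp
qed

text \<open>The inner product of two means depends only on the later index, so the squared distance
  of the means at \<open>p \<le> q\<close> is \<open>b - a\<close> times the difference of
  \<open>1/(p+1)\<close> and \<open>1/(q+1)\<close>. The shifted means have the same limit because
  they differ by \<open>(x (p+1) - x 0)/(p+1)\<close> and all \<open>x k\<close> have norm
  \<open>sqrt b\<close>.\<close>

lemma cesaro_convergent_of_constant_gram: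
  fixes x :: "nat \<Rightarrow> 'a::{real_inner,banach}"
  assumes gram: "\<And>k l. inner (x k) (x l) = (if k = l then b else a)"
  obtains u where "(\<lambda>p. inverse (real (Suc p)) *\<^sub>R (\<Sum>k<Suc p. x k)) \<longlonglongrightarrow> u"
    and "(\<lambda>p. inverse (real (Suc p)) *\<^sub>R (\<Sum>k<Suc p. x (Suc k))) \<longlonglongrightarrow> u"
proof -
  define S where "S p = (\<Sum>k<p. x k)" for p
  define m where "m p = inverse (real (Suc p)) *\<^sub>R S (Suc p)" for p
  have SS: "inner (S p) (S q) = real p * (real q * a + (b - a))" if "p \<le> q" for p q
  proof -
    have "inner (S p) (S q) = (\<Sum>k<p. \<Sum>l<q. a + (if k = l then b - a else 0))"
      unfolding S_def inner_sum_left unfolding inner_sum_right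
      by (intro sum.cong refl) (simp add: gram)
    also have "\<dots> = (\<Sum>k<p. real q * a + (b - a))"
      by (intro sum.cong refl) (use that in \<open>simp add: sum.distrib\<close>)
    finally show ?thesis by simp
  qed
  have mm: "inner (m p) (m q) = a + (b - a) / real (Suc q)" if "p \<le> q" for p q
  proof -
    have "inner (m p) (m q) = inverse (real (Suc p)) * (inverse (real (Suc q)) *
        (real (Suc p) * (real (Suc q) * a + (b - a))))"
      using SS[of "Suc p" "Suc q"] that unfolding m_def by (simp del: of_nat_Suc)
    also have "\<dots> = a + (b - a) / real (Suc q)"
      by (simp add: field_simps del: of_nat_Suc)
    finally show ?thesis .
  qed
  have dm: "(dist (m p) (m q))\<^sup>2 \<le> \<bar>b - a\<bar> * inverse (real (Suc p))" if "p \<le> q" for p q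
  proof -
    have "(dist (m p) (m q))\<^sup>2 = (b - a) * (inverse (real (Suc p)) - inverse (real (Suc q)))"
      using mm[OF that] mm[of p p] mm[of q q] inner_commute[of "m p" "m q"]
      by (simp add: dist_norm power2_norm_eq_inner inner_diff_left inner_diff_right
          divide_inverse right_diff_distrib del: of_nat_Suc)
    also have "\<dots> \<le> \<bar>b - a\<bar> * \<bar>inverse (real (Suc p)) - inverse (real (Suc q))\<bar>"
      unfolding abs_mult[symmetric] by (rule abs_ge_self)
    also have "\<dots> \<le> \<bar>b - a\<bar> * inverse (real (Suc p))"
    proof -
      have "inverse (real (Suc q)) \<le> inverse (real (Suc p))"
        using that by (intro le_imp_inverse_le) auto
      moreover have "0 \<le> inverse (real (Suc q))" by simp
      ultimately show ?thesis by (intro mult_left_mono) (simp_all del: of_nat_Suc)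
    qed
    finally show ?thesis .
  qed
  have "Cauchy m"
  proof (rule metric_CauchyI)
    fix e :: real assume e: "e > 0"
    \<comment> \<open>The summand 1 keeps the denominator positive when
      \<open>a = b\<close>.\<close>
    have "e\<^sup>2 / (\<bar>b - a\<bar> + 1) > 0" using e by (intro divide_pos_pos) auto
    then obtain N where "inverse (real (Suc N)) < e\<^sup>2 / (\<bar>b - a\<bar> + 1)"
      using reals_Archimedean by blast
    then have N: "(\<bar>b - a\<bar> + 1) * inverse (real (Suc N)) < e\<^sup>2"
      by (simp add: pos_less_divide_eq mult.commute add_pos_nonneg add_nonneg_pos del: of_nat_Suc)
    have *: "dist (m p) (m q) < e" if "N \<le> p" "p \<le> q" for p q
    proof -
      have "inverse (real (Suc p)) \<le> inverse (real (Suc N))"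
        using that by (intro le_imp_inverse_le) auto
      then have "\<bar>b - a\<bar> * inverse (real (Suc p)) \<le> (\<bar>b - a\<bar> + 1) * inverse (real (Suc N))"
        by (intro mult_mono) auto
      then have "(dist (m p) (m q))\<^sup>2 < e\<^sup>2" using dm[OF that(2)] N by linarith
      then show ?thesis using e by (simp add: power_less_imp_less_base)
    qed
    have "dist (m p) (m q) < e" if "p \<ge> N" "q \<ge> N" for p q
      using *[of p q] *[of q p] that by (cases "p \<le> q") (auto simp: dist_commute)
    then show "\<exists>N. \<forall>p\<ge>N. \<forall>q\<ge>N. dist (m p) (m q) < e" by blast
  qed
  then obtain u where u: "m \<longlonglongrightarrow> u" using Cauchy_convergent convergent_def by blast
  have nx: "norm (x k) = sqrt b" for k by (simp add: norm_eq_sqrt_inner gram)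
  have "(\<lambda>p. inverse (real (Suc p)) *\<^sub>R (x (Suc p) - x 0)) \<longlonglongrightarrow> 0"
  proof (rule tendsto_norm_zero_cancel, rule Lim_null_comparison)
    show "\<forall>\<^sub>F p in sequentially. norm (norm (inverse (real (Suc p)) *\<^sub>R (x (Suc p) - x 0)))
        \<le> inverse (real (Suc p)) * (2 * sqrt b)"
    proof (intro always_eventually allI)
      fix p
      have "norm (x (Suc p) - x 0) \<le> 2 * sqrt b"
        using norm_triangle_ineq4[of "x (Suc p)" "x 0"] by (simp add: nx)
      then show "norm (norm (inverse (real (Suc p)) *\<^sub>R (x (Suc p) - x 0)))
        \<le> inverse (real (Suc p)) * (2 * sqrt b)"
        by (simp add: mult_left_mono del: of_nat_Suc)
    qed
    show "(\<lambda>p. inverse (real (Suc p)) * (2 * sqrt b)) \<longlonglongrightarrow> 0"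
      by (rule tendsto_mult_left_zero[OF LIMSEQ_inverse_real_of_nat])
  qed
  then have "(\<lambda>p. m p + inverse (real (Suc p)) *\<^sub>R (x (Suc p) - x 0)) \<longlonglongrightarrow> u + 0"
    by (intro tendsto_add u)
  moreover have "m p + inverse (real (Suc p)) *\<^sub>R (x (Suc p) - x 0)
      = inverse (real (Suc p)) *\<^sub>R (\<Sum>k<Suc p. x (Suc k))" for p
  proof -
    have "S (Suc p) + (x (Suc p) - x 0) = (\<Sum>k<Suc p. x (Suc k))"
      using sum.lessThan_Suc_shift[of x "Suc p"] by (simp add: S_def)
    then show ?thesis unfolding m_def by (metis scaleR_add_right)
  qed
  ultimately show ?thesis using that[of u] u by (simp add: m_def[abs_def] S_def)
qed

section \<open>Absolute values of self-adjoint operators and a Schur lemma\<close>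

text \<open>The absolute value is \<open>1 - Z\<close>, where \<open>Z\<close> is the limit of the iteration
  \<open>Y \<mapsto> (1 - T\<^sup>2 + Y\<^sup>2) / 2\<close> started at \<open>0\<close>; its increments are dominated by those of the scalar
  iteration \<open>y \<mapsto> (1 + y\<^sup>2) / 2\<close>, which increases and stays below \<open>1\<close>.\<close>

lemma contraction_abs:
  fixes T :: "'a::{real_inner,banach} \<Rightarrow> 'a"
  assumes T: "bounded_linear T" and sa: "\<And>x y. inner (T x) y = inner x (T y)"
    and le: "\<And>x. norm (T x) \<le> norm x"
  shows "\<exists>S. bounded_linear S \<and> (\<forall>x. S (S x) = T (T x)) \<and> (\<forall>x. 0 \<le> inner (S x) x) \<and>
           (\<forall>R. bounded_linear R \<longrightarrow> (\<forall>x. R (T x) = T (R x)) \<longrightarrow> (\<forall>x. R (S x) = S (R x)))"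
proof -
  define t where "t = Blinfun T"
  have t: "blinfun_apply t = T" unfolding t_def using T by (rule bounded_linear_Blinfun_apply)
  define B where "B = id_blinfun - (t o\<^sub>L t)"
  have Bx: "B x = x - T (T x)" for x by (simp add: B_def blinfun.bilinear_simps t)
  have B1: "norm B \<le> 1"
  proof (rule norm_blinfun_bound)
    fix x
    have "norm (T (T x)) \<le> norm (T x)" by (rule le)
    then have "(norm (T (T x)))\<^sup>2 \<le> (norm (T x))\<^sup>2" by (simp add: power_mono)
    moreover have "(norm (B x))\<^sup>2 = (norm x)\<^sup>2 - 2 * (norm (T x))\<^sup>2 + (norm (T (T x)))\<^sup>2"
      unfolding Bx power2_norm_eq_inner using sa[of x "T x"]
      by (simp add: inner_diff inner_commute)
    ultimately have "(norm (B x))\<^sup>2 \<le> (norm x)\<^sup>2"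
      using zero_le_power2[of "norm (T x)"] by linarith
    then have "norm (B x) \<le> norm x" by (rule power2_le_imp_le) simp
    then show "norm (B x) \<le> 1 * norm x" by simp
  qed simp
  define y where "y = rec_nat (0::real) (\<lambda>_ y. (1 + y\<^sup>2) / 2)"
  define Y where "Y = rec_nat 0 (\<lambda>_ Y. (1/2) *\<^sub>R (B + (Y o\<^sub>L Y)))"
  have y: "y 0 = 0" "\<And>k. y (Suc k) = (1 + (y k)\<^sup>2) / 2" unfolding y_def by simp_all
  have Y: "Y 0 = 0" "\<And>k. Y (Suc k) = (1/2) *\<^sub>R (B + (Y k o\<^sub>L Y k))" unfolding Y_def by simp_all
  have y01: "0 \<le> y k \<and> y k \<le> 1" for k
    by (induct k) (auto simp: y power_le_one)
  have yinc: "y k \<le> y (Suc k)" for k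
    using zero_le_power2[of "y k - 1"] by (simp add: y power2_eq_square algebra_simps)
  have Yy: "norm (Y k) \<le> y k" for k
  proof (induct k)
    case (Suc k)
    have "norm (Y k o\<^sub>L Y k) \<le> norm (Y k) * norm (Y k)" by (rule norm_blinfun_compose)
    also have "\<dots> \<le> y k * y k" using Suc by (intro mult_mono) (auto simp: y01)
    finally have "norm (B + (Y k o\<^sub>L Y k)) \<le> 1 + (y k)\<^sup>2"
      using B1 norm_triangle_le[of B "Y k o\<^sub>L Y k" "1 + (y k)\<^sup>2"] by (simp add: power2_eq_square)
    then show ?case by (simp add: Y y)
  qed (simp add: Y y)
  have step: "norm (Y (Suc k) - Y k) \<le> y (Suc k) - y k" for k
  proof (induct k)
    case 0
    then show ?case using B1 by (simp add: Y y)
  next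
    case (Suc k)
    let ?D = "Y (Suc k) - Y k"
    \<comment> \<open>A difference of two squares, split so that the factors need not
      commute.\<close>
    have eq: "Y (Suc (Suc k)) - Y (Suc k) = (1/2) *\<^sub>R ((Y (Suc k) o\<^sub>L ?D) + (?D o\<^sub>L Y k))"
      by (subst Y(2), subst (2) Y(2), rule blinfun_eqI)
        (simp add: blinfun.bilinear_simps scaleR_diff_right scaleR_add_right algebra_simps)
    have "norm (Y (Suc k) o\<^sub>L ?D) \<le> y (Suc k) * (y (Suc k) - y k)"
      by (rule order_trans[OF norm_blinfun_compose] mult_mono)+ (use Suc Yy y01 in auto)
    moreover have "norm (?D o\<^sub>L Y k) \<le> (y (Suc k) - y k) * y k"
      by (rule order_trans[OF norm_blinfun_compose] mult_mono)+ (use Suc Yy y01 yinc[of k] in auto)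
    ultimately have "norm ((Y (Suc k) o\<^sub>L ?D) + (?D o\<^sub>L Y k)) \<le> (y (Suc k))\<^sup>2 - (y k)\<^sup>2"
      by (intro norm_triangle_le) (simp add: power2_eq_square algebra_simps)
    moreover have "y (Suc (Suc k)) - y (Suc k) = (1/2) * ((y (Suc k))\<^sup>2 - (y k)\<^sup>2)"
      by (subst y(2), subst (2) y(2)) (simp add: field_simps)
    ultimately show ?case unfolding eq norm_scaleR by simp
  qed
  have diff: "norm (Y (k + m) - Y k) \<le> y (k + m) - y k" for k m
  proof (induct m)
    case (Suc m)
    then show ?case using step[of "k + m"]
      norm_triangle_le[of "Y (k + Suc m) - Y (k + m)" "Y (k + m) - Y k" "y (k + Suc m) - y k"] by simp
  qed simp
  have "convergent y"
  proof (rule Bseq_mono_convergent)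
    show "Bseq y" by (rule BseqI'[of _ 1]) (use y01 in simp)
    show "\<forall>k l. k \<le> l \<longrightarrow> y k \<le> y l" by (blast intro: lift_Suc_mono_le yinc)
  qed
  then have "Cauchy y" by (simp add: Cauchy_convergent_iff)
  have "Cauchy Y"
  proof (rule metric_CauchyI)
    fix e :: real assume "e > 0"
    then obtain N where N: "\<And>k l. k \<ge> N \<Longrightarrow> l \<ge> N \<Longrightarrow> dist (y k) (y l) < e"
      using \<open>Cauchy y\<close> by (metis metric_CauchyD)
    have *: "dist (Y l) (Y k) < e" if "k \<ge> N" "l \<ge> k" for k l
      using diff[of k "l - k"] N[of l k] that by (simp add: dist_norm)
    have "dist (Y k) (Y l) < e" if "k \<ge> N" "l \<ge> N" for k l
      using *[of k l] *[of l k] that by (cases "l \<ge> k") (auto simp: dist_commute)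
    then show "\<exists>N. \<forall>k\<ge>N. \<forall>l\<ge>N. dist (Y k) (Y l) < e" by blast
  qed
  then obtain Z where Z: "Y \<longlonglongrightarrow> Z" using Cauchy_convergent convergent_def by blast
  have "(\<lambda>k. (1/2) *\<^sub>R (B + (Y k o\<^sub>L Y k))) \<longlonglongrightarrow> (1/2) *\<^sub>R (B + (Z o\<^sub>L Z))"
    by (intro tendsto_intros bounded_bilinear.tendsto[OF bounded_bilinear_blinfun_compose] Z)
  moreover have "(\<lambda>k. Y (Suc k)) \<longlonglongrightarrow> Z" using Z by (simp add: filterlim_sequentially_Suc)
  ultimately have ZZ: "Z = (1/2) *\<^sub>R (B + (Z o\<^sub>L Z))"
    unfolding Y(2) using LIMSEQ_unique by blast
  have nZ: "norm Z \<le> 1"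
    using tendsto_norm[OF Z] by (rule LIMSEQ_le_const2) (use Yy y01 order_trans in blast)
  \<comment> \<open>The fixed point equation \<open>ZZ\<close> says that the square of
    \<open>1 - Z\<close> is \<open>T \<circ> T\<close>, and \<open>nZ\<close> makes
    \<open>1 - Z\<close> positive.\<close>
  define S where "S x = x - Z x" for x
  have "S (S x) = T (T x)" for x
  proof -
    have "2 *\<^sub>R Z x = B x + Z (Z x)" by (subst ZZ) (simp add: blinfun.bilinear_simps)
    then show ?thesis by (simp add: S_def Bx blinfun.bilinear_simps scaleR_2 algebra_simps)
  qed
  moreover have "0 \<le> inner (S x) x" for x
  proof -
    have "norm (Z x) \<le> 1 * norm x"
      by (rule order_trans[OF norm_blinfun mult_right_mono[OF nZ]]) simp
    then have "norm (Z x) * norm x \<le> norm x * norm x" by (simp add: mult_right_mono)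
    then have "inner (Z x) x \<le> inner x x"
      using norm_cauchy_schwarz[of "Z x" x] by (simp add: power2_norm_eq_inner[symmetric] power2_eq_square)
    then show ?thesis by (simp add: S_def inner_diff_left)
  qed
  moreover have "R (S x) = S (R x)" if R: "bounded_linear R" and comm: "\<forall>x. R (T x) = T (R x)" for R x
  proof -
    interpret R: bounded_linear R by fact
    \<comment> \<open>Every \<open>Y k\<close> is a polynomial in the square of \<open>T\<close>, so
      it inherits the commutation; the limit \<open>Z\<close> then does too.\<close>
    have Yc: "R (Y k x) = Y k (R x)" for k x
      by (induct k arbitrary: x) (simp_all add: Y R.zero R.scaleR R.add R.diff blinfun.bilinear_simps Bx comm)
    have Yx: "(\<lambda>k. Y k x) \<longlonglongrightarrow> Z x" for x by (intro tendsto_intros Z)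
    have "(\<lambda>k. R (Y k x)) \<longlonglongrightarrow> R (Z x)" by (intro R.tendsto Yx)
    then have "R (Z x) = Z (R x)" unfolding Yc using Yx LIMSEQ_unique by blast
    then show ?thesis by (simp add: S_def R.diff)
  qed
  moreover have "bounded_linear S"
    unfolding S_def by (intro bounded_linear_intros)
  ultimately show ?thesis by blast
qed

text \<open>Dividing by a bound \<open>c\<close> reduces to a contraction. The last conjunct places
  the absolute value in the double commutant of \<open>T\<close>, which makes the kernel used in
  \<open>selfadjoint_schur\<close> invariant.\<close>

lemma selfadjoint_abs:
  fixes T :: "'a::{real_inner,banach} \<Rightarrow> 'a"
  assumes T: "bounded_linear T" and sa: "\<And>x y. inner (T x) y = inner x (T y)"
  shows "\<exists>S. bounded_linear S \<and> (\<forall>x. S (S x) = T (T x)) \<and> (\<forall>x. 0 \<le> inner (S x) x) \<and>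
           (\<forall>R. bounded_linear R \<longrightarrow> (\<forall>x. R (T x) = T (R x)) \<longrightarrow> (\<forall>x. R (S x) = S (R x)))"
proof -
  interpret T: bounded_linear T by fact
  obtain c where c: "c > 0" "\<And>x. norm (T x) \<le> norm x * c" using T.pos_bounded by blast
  let ?T = "\<lambda>x. inverse c *\<^sub>R T x"
  have "bounded_linear ?T" by (intro bounded_linear_intros T)
  moreover have "inner (?T x) y = inner x (?T y)" for x y by (simp add: sa)
  moreover have "norm (?T x) \<le> norm x" for x using c by (simp add: field_simps)
  ultimately obtain S where S: "bounded_linear S" "\<And>x. S (S x) = ?T (?T x)" "\<And>x. 0 \<le> inner (S x) x"
    "\<And>R x. bounded_linear R \<Longrightarrow> (\<forall>x. R (?T x) = ?T (R x)) \<Longrightarrow> R (S x) = S (R x)"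
    using contraction_abs[of ?T] by blast
  interpret S: bounded_linear S by fact
  show ?thesis
  proof (intro exI[of _ "\<lambda>x. c *\<^sub>R S x"] conjI allI impI)
    show "bounded_linear (\<lambda>x. c *\<^sub>R S x)" by (intro bounded_linear_intros S)
    show "c *\<^sub>R S (c *\<^sub>R S x) = T (T x)" for x
      using c(1) by (simp add: S.scaleR S(2) T.scaleR field_simps)
    show "0 \<le> inner (c *\<^sub>R S x) x" for x using c(1) S(3) by simp
    fix R x assume R: "bounded_linear R" "\<forall>x. R (T x) = T (R x)"
    interpret R: bounded_linear R by fact
    have "R (S x) = S (R x)" by (rule S(4)[OF R(1)]) (simp add: R(2) R.scaleR)
    then show "R (c *\<^sub>R S x) = c *\<^sub>R S (R x)" by (simp add: R.scaleR)
  qed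
qed

text \<open>Let \<open>S\<close> be the absolute value of \<open>T - m\<close>. The kernel of
  \<open>S + (T - m)\<close> in \<open>C\<close> is invariant under the family, hence
  \<open>{0}\<close> or \<open>C\<close>. In the second case \<open>T \<le> m\<close> on
  \<open>C\<close>; in the first case \<open>S = T - m\<close> there, so \<open>T \<ge> m\<close>.
  Hence no \<open>m\<close> lies strictly between two values of the Rayleigh quotient of
  \<open>T\<close> on \<open>C\<close>, and \<open>T\<close> is a scalar on \<open>C\<close>. The
  operators live on the whole space, and commutation with \<open>P\<close> keeps \<open>T\<close>
  and \<open>S\<close> inside \<open>C\<close>.\<close>

lemma selfadjoint_schur:
  fixes T P :: "'a::{real_inner,banach} \<Rightarrow> 'a"
  assumes T: "bounded_linear T" and sa: "\<And>x y. inner (T x) y = inner x (T y)"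
    and P: "bounded_linear P" "\<And>x. P x \<in> C" "\<And>x. x \<in> C \<Longrightarrow> P x = x" "\<And>x. P (T x) = T (P x)"
    and C: "subspace C" "closed C"
    and R: "\<And>R. R \<in> \<R> \<Longrightarrow> bounded_linear R" "\<And>R x. R \<in> \<R> \<Longrightarrow> R (T x) = T (R x)"
      "\<And>R x. R \<in> \<R> \<Longrightarrow> x \<in> C \<Longrightarrow> R x \<in> C"
    and irr: "\<And>D. subspace D \<Longrightarrow> closed D \<Longrightarrow> D \<subseteq> C \<Longrightarrow> (\<And>R x. R \<in> \<R> \<Longrightarrow> x \<in> D \<Longrightarrow> R x \<in> D)
           \<Longrightarrow> D = {0} \<or> D = C"
  shows "\<exists>c. \<forall>x\<in>C. T x = c *\<^sub>R x"
proof -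
  interpret T: bounded_linear T by fact
  interpret P: bounded_linear P by fact
  have dich: "(\<forall>x\<in>C. m * inner x x \<le> inner (T x) x) \<or> (\<forall>x\<in>C. inner (T x) x \<le> m * inner x x)" for m
  proof -
    let ?T = "\<lambda>x. T x - m *\<^sub>R x"
    have "bounded_linear ?T" by (intro bounded_linear_intros T)
    moreover have "inner (?T x) y = inner x (?T y)" for x y
      by (simp add: inner_diff sa)
    ultimately obtain S where S: "bounded_linear S" "\<And>x. S (S x) = ?T (?T x)" "\<And>x. 0 \<le> inner (S x) x"
      "\<And>R x. bounded_linear R \<Longrightarrow> (\<forall>x. R (?T x) = ?T (R x)) \<Longrightarrow> R (S x) = S (R x)"
      using selfadjoint_abs[of ?T] by blast
    interpret S: bounded_linear S by fact
    have Scomm: "R (S x) = S (R x)" if "bounded_linear R" "\<And>x. R (T x) = T (R x)" for R x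
    proof -
      interpret R: bounded_linear R by fact
      show ?thesis by (rule S(4)) (auto simp: that R.diff R.scaleR)
    qed
    have ST: "S (T x) = T (S x)" for x using Scomm[OF T] by simp
    have SC: "S x \<in> C" if "x \<in> C" for x
      using Scomm[OF P(1) P(4), of x] P(2,3) that by metis
    have TC: "T x \<in> C" if "x \<in> C" for x
      using P(2-4) that by metis
    let ?D = "{x \<in> C. S x + ?T x = 0}"
    have "subspace ?D"
    proof (rule subspaceI)
      show "0 \<in> ?D" using C(1) by (simp add: subspace_0 S.zero T.zero)
      show "x + y \<in> ?D" if "x \<in> ?D" "y \<in> ?D" for x y
      proof -
        have "S (x + y) + ?T (x + y) = (S x + ?T x) + (S y + ?T y)"
          by (simp add: S.add T.add scaleR_add_right)
        then show ?thesis using that C(1) by (simp add: subspace_add)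
      qed
      show "r *\<^sub>R x \<in> ?D" if "x \<in> ?D" for r x
      proof -
        have "S (r *\<^sub>R x) + ?T (r *\<^sub>R x) = r *\<^sub>R (S x + ?T x)"
          by (simp add: S.scaleR T.scaleR scaleR_add_right scaleR_diff_right)
        then show ?thesis using that C(1) by (simp add: subspace_scale)
      qed
    qed
    moreover have "closed ?D"
    proof -
      have "closed {x. S x + ?T x = 0}"
        by (intro closed_Collect_eq continuous_intros S.continuous_on T.continuous_on)
      then show ?thesis using closed_Int[OF C(2)] by (simp add: Collect_conj_eq)
    qed
    moreover have "Q x \<in> ?D" if "Q \<in> \<R>" "x \<in> ?D" for Q x
    proof -
      interpret Q: bounded_linear Q using R(1) that(1) .
      have "Q (S x + ?T x) = S (Q x) + ?T (Q x)"
        using Scomm[OF R(1)[OF that(1)] R(2)[OF that(1)]] R(2)[OF that(1)]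
        by (simp add: Q.add Q.diff Q.scaleR)
      then show ?thesis using that R(3) by (simp add: Q.zero)
    qed
    ultimately consider "?D = {0}" | "?D = C" using irr[of ?D] by blast
    then show ?thesis
    proof cases
      case 1
      have "inner (S x) x = inner (?T x) x" if x: "x \<in> C" for x
      proof -
        \<comment> \<open>\<open>S\<close> commutes with \<open>?T\<close> and both have the same
          square, so \<open>S + ?T\<close> annihilates the range of \<open>S - ?T\<close>.\<close>
        have "S x - ?T x \<in> ?D"
          using x C(1) SC TC by (auto simp: subspace_diff subspace_scale S.diff S.scaleR T.diff T.scaleR S(2) ST scaleR_diff_right)
        then show ?thesis using 1 by auto
      qed
      then show ?thesis using S(3) by (auto simp: inner_diff_left) (metis diff_ge_0_iff_ge)
    next
      case 2
      have "inner (T x) x \<le> m * inner x x" if "x \<in> C" for x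
      proof -
        have "S x + ?T x = 0" using 2 that by blast
        then have "S x = - ?T x" by (simp only: eq_neg_iff_add_eq_0)
        then show ?thesis using S(3)[of x] by (simp add: inner_diff_left)
      qed
      then show ?thesis by blast
    qed
  qed
  show ?thesis
  proof (cases "C \<subseteq> {0}")
    case True
    then show ?thesis by (intro exI[of _ 0]) (auto simp: T.zero)
  next
    case False
    then obtain v where v: "v \<in> C" "v \<noteq> 0" by auto
    define c where "c = inner (T v) v / inner v v"
    have vv: "inner v v > 0" using v by simp
    have cv: "inner (T v) v = c * inner v v" using v by (simp add: c_def)
    have form: "inner (T x) x = c * inner x x" if x: "x \<in> C" for x
    proof (cases "x = 0")
      case False
      then have xx: "inner x x > 0" by simp
      \<comment> \<open>The midpoint of the Rayleigh quotients at \<open>v\<close> and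
        \<open>x\<close>; if they differed, \<open>m\<close> would separate them strictly, against
        \<open>dich\<close>.\<close>
      define m where "m = (c + inner (T x) x / inner x x) / 2"
      show ?thesis
      proof (rule ccontr)
        assume ne: "\<not> ?thesis"
        have 1: "m * inner x x = (c * inner x x + inner (T x) x) / 2"
          using xx by (simp add: m_def field_simps)
        have 2: "inner (T x) x = (2 * m - c) * inner x x"
          using xx by (simp add: m_def add_divide_distrib)
        from dich[of m] show False
        proof
          assume "\<forall>x\<in>C. m * inner x x \<le> inner (T x) x"
          then have "m * inner x x \<le> inner (T x) x" "m * inner v v \<le> inner (T v) v" using x v by auto
          then have "m \<le> c" "m \<le> 2 * m - c" using xx vv unfolding cv 2 by simp_all
          then have "m = c" by simp
          then show False using 2 ne by simp
        next
          assume "\<forall>x\<in>C. inner (T x) x \<le> m * inner x x"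
          then have "inner (T x) x \<le> m * inner x x" "inner (T v) v \<le> m * inner v v" using x v by auto
          then have "c \<le> m" "2 * m - c \<le> m" using xx vv unfolding cv 2 by simp_all
          then have "m = c" by simp
          then show False using 2 ne by simp
        qed
      qed
    qed (simp add: T.zero)
    have "T x = c *\<^sub>R x" if x: "x \<in> C" for x
    proof -
      let ?y = "T x - c *\<^sub>R x"
      have y: "?y \<in> C" using x C(1) P(2-4) by (metis subspace_diff subspace_scale)
      \<comment> \<open>Polarisation of the quadratic form, using that \<open>T\<close> is
        symmetric.\<close>
      have "inner (T x) z = c * inner x z" if z: "z \<in> C" for z
        using form[of "x + z"] form[OF x] form[OF z] x z C(1) sa[of x z] inner_commute[of x "T z"]
          inner_commute[of x z]
        by (simp add: subspace_add T.add inner_add_left inner_add_right algebra_simps)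
      from this[OF y] have "inner ?y ?y = 0" by (simp add: inner_diff_left)
      then show ?thesis by simp
    qed
    then show ?thesis by blast
  qed
qed

section \<open>Complex subspaces and operators\<close>

lemma norm_imult [simp]: "norm (imult x) = norm (x :: 'a::chilbert)"
  by (simp add: norm_eq_sqrt_inner imult_inner)

lemma bounded_linear_imult: "bounded_linear (imult :: 'a::chilbert \<Rightarrow> 'a)"
  by (rule bounded_linear_intro[of _ 1]) (auto simp: imult_add imult_scaleR)

lemma inner_imult_left: "inner (imult x) y = - inner x (imult (y :: 'a::chilbert))"
  using imult_inner[of x "imult y"] by (simp add: imult_imult)

lemma clinear_op_id: "clinear_op id"
  by (auto simp: clinear_op_def id_def)

lemma clinear_op_compose: "clinear_op S \<Longrightarrow> clinear_op T \<Longrightarrow> clinear_op (S \<circ> T)"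
  by (auto simp: clinear_op_def comp_def intro: bounded_linear_compose)

lemma clinear_op_word: "(\<And>i. i \<in> set \<alpha> \<Longrightarrow> clinear_op (V i)) \<Longrightarrow> clinear_op (word V \<alpha>)"
  by (induct \<alpha>) (simp_all add: clinear_op_id clinear_op_compose)

lemma clinear_op_scaleC: "clinear_op T \<Longrightarrow> T (scaleC c x) = scaleC c (T x)"
  by (auto simp: clinear_op_def scaleC_def bounded_linear.linear linear_add linear_scale)

lemma word_append: "word V (\<alpha> @ \<beta>) x = word V \<alpha> (word V \<beta> x)"
  by (induct \<alpha>) simp_all

lemma word_in: "x \<in> M \<Longrightarrow> (\<And>i y. i \<in> set \<alpha> \<Longrightarrow> y \<in> M \<Longrightarrow> V i y \<in> M) \<Longrightarrow> word V \<alpha> x \<in> M"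
  by (induct \<alpha>) auto

lemma csubspace_vimage: "clinear_op T \<Longrightarrow> csubspace M \<Longrightarrow> csubspace {x. T x \<in> M}"
  unfolding csubspace_def clinear_op_def
  by (auto simp: image_subset_iff subspace_def bounded_linear.linear linear_0 linear_add linear_scale)

lemma closed_csubspace_vimage:
  assumes "clinear_op T" "closed_csubspace M"
  shows "closed_csubspace {x. T x \<in> M}"
proof -
  have "continuous_on UNIV T" using assms by (simp add: clinear_op_def linear_continuous_on)
  then have "closed {x. T x \<in> M}"
    using assms continuous_closed_vimage[of M T] by (simp add: closed_csubspace_def vimage_def continuous_on_eq_continuous_at)
  then show ?thesis using assms csubspace_vimage[of T M] by (simp add: closed_csubspace_def)
qed

lemma closed_csubspace_zero: "closed_csubspace {0}"
  using linear_0[OF bounded_linear.linear[OF bounded_linear_imult]]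
  by (simp add: closed_csubspace_def csubspace_def subspace_single_0)

lemma closed_csubspace_kernel:
  assumes "clinear_op T"
  shows "closed_csubspace {x. T x = 0}"
  using closed_csubspace_vimage[OF assms closed_csubspace_zero] by simp

lemma closed_csubspace_Inter:
  "(\<And>M. M \<in> \<M> \<Longrightarrow> closed_csubspace M) \<Longrightarrow> closed_csubspace (\<Inter>\<M>)"
  unfolding closed_csubspace_def csubspace_def
  by (intro conjI subspace_Inter closed_Inter ballI) blast+

lemma closed_csubspace_Int:
  "closed_csubspace M \<Longrightarrow> closed_csubspace N \<Longrightarrow> closed_csubspace (M \<inter> N)"
  using closed_csubspace_Inter[of "{M, N}"] by auto

lemma csubspace_cspan: "csubspace (cspan S)"
proof -
  have "imult ` cspan S \<subseteq> span (imult ` (S \<union> imult ` S))"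
    unfolding cspan_def
    by (simp add: linear_span_image[OF bounded_linear.linear[OF bounded_linear_imult]])
  also have "\<dots> \<subseteq> cspan S"
    unfolding cspan_def by (rule span_minimal) (auto simp: image_Un image_image imult_imult span_base span_neg)
  finally show ?thesis by (simp add: csubspace_def) (simp add: cspan_def)
qed

lemma subspace_closure:
  fixes M :: "'a::real_normed_vector set"
  assumes "subspace M"
  shows "subspace (closure M)"
proof (rule subspaceI)
  show "0 \<in> closure M" using assms closure_subset subspace_0 by blast
  fix x y c assume x: "x \<in> closure M"
  then obtain f where f: "\<And>k. f k \<in> M" "f \<longlonglongrightarrow> x" unfolding closure_sequential by blast
  have "c *\<^sub>R f k \<in> M" for k using f(1) assms by (simp add: subspace_scale)
  moreover have "(\<lambda>k. c *\<^sub>R f k) \<longlonglongrightarrow> c *\<^sub>R x" by (intro tendsto_intros f)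
  ultimately show "c *\<^sub>R x \<in> closure M"
    unfolding closure_sequential by (intro exI[of _ "\<lambda>k. c *\<^sub>R f k"]) simp
  assume "y \<in> closure M"
  then obtain g where g: "\<And>k. g k \<in> M" "g \<longlonglongrightarrow> y" unfolding closure_sequential by blast
  have "f k + g k \<in> M" for k using f(1) g(1) assms by (simp add: subspace_add)
  moreover have "(\<lambda>k. f k + g k) \<longlonglongrightarrow> x + y" by (intro tendsto_intros f g)
  ultimately show "x + y \<in> closure M"
    unfolding closure_sequential by (intro exI[of _ "\<lambda>k. f k + g k"]) simp
qed

lemma closed_csubspace_closure:
  assumes "csubspace M"
  shows "closed_csubspace (closure M)"
proof -
  have "imult ` closure M \<subseteq> closure (imult ` M)"
    by (intro closure_bounded_linear_image_subset bounded_linear_imult)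
  also have "\<dots> \<subseteq> closure M" using assms by (intro closure_mono) (simp add: csubspace_def)
  finally show ?thesis using assms by (simp add: closed_csubspace_def csubspace_def subspace_closure)
qed

lemma closure_cspan_superset: "S \<subseteq> closure (cspan S)"
  unfolding cspan_def by (meson Un_upper1 closure_subset order_trans span_superset)

lemma closure_cspan_least: "S \<subseteq> M \<Longrightarrow> closed_csubspace M \<Longrightarrow> closure (cspan S) \<subseteq> M"
  unfolding cspan_def closed_csubspace_def csubspace_def
  by (intro closure_minimal span_minimal) auto

lemma clinear_op_closure_cspan:
  assumes "clinear_op T" "closed_csubspace M" "\<And>x. x \<in> S \<Longrightarrow> T x \<in> M" "x \<in> closure (cspan S)"
  shows "T x \<in> M"
  using closure_cspan_least[OF _ closed_csubspace_vimage[OF assms(1,2)], of S] assms(3,4) by auto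

lemma scaleC_in: "csubspace M \<Longrightarrow> x \<in> M \<Longrightarrow> scaleC c x \<in> M"
  by (auto simp: csubspace_def scaleC_def image_subset_iff subspace_add subspace_scale)

section \<open>Orthogonal complements, projections and adjoints inside a subspace\<close>

lemma orthogonal_comp_iff: "x \<in> orthogonal_comp M \<longleftrightarrow> (\<forall>y\<in>M. inner y x = 0)"
  by (auto simp: orthogonal_comp_def orthogonal_def)

lemma closed_csubspace_orthogonal_comp:
  assumes "closed_csubspace M"
  shows "closed_csubspace (orthogonal_comp M)"
proof -
  have eq: "orthogonal_comp M = (\<Inter>y\<in>M. {x. inner y x = 0})"
    by (auto simp: orthogonal_comp_iff)
  have "closed (orthogonal_comp M)"
    unfolding eq by (intro closed_INT ballI closed_Collect_eq continuous_intros)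
  moreover have "imult ` orthogonal_comp M \<subseteq> orthogonal_comp M"
  proof clarify
    fix x assume x: "x \<in> orthogonal_comp M"
    have "inner y (imult x) = 0" if "y \<in> M" for y
    proof -
      have "imult y \<in> M" using assms that by (auto simp: closed_csubspace_def csubspace_def)
      then have "inner (imult y) x = 0" using x by (simp add: orthogonal_comp_iff)
      then show ?thesis by (simp add: inner_imult_left)
    qed
    then show "imult x \<in> orthogonal_comp M" by (simp add: orthogonal_comp_iff)
  qed
  ultimately show ?thesis
    by (simp add: closed_csubspace_def csubspace_def subspace_orthogonal_comp)
qed

lemma orthogonal_comp_Int: "x \<in> M \<Longrightarrow> x \<in> orthogonal_comp M \<Longrightarrow> x = 0"
  by (auto simp: orthogonal_comp_iff)

lemma orthogonal_decomposition:
  fixes M :: "'a::chilbert set"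
  assumes "closed_csubspace M"
  obtains y where "y \<in> M" "x - y \<in> orthogonal_comp M"
proof -
  obtain y where "y \<in> M" "\<And>z. z \<in> M \<Longrightarrow> inner (x - y) z = 0"
    using orthogonal_projection_exists[of M x] assms
    unfolding closed_csubspace_def csubspace_def by metis
  then show ?thesis using that[of y] by (simp add: orthogonal_comp_iff inner_commute)
qed

lemma oproj_eqI:
  assumes "subspace M" "y \<in> M" "\<And>z. z \<in> M \<Longrightarrow> inner (x - y) z = 0"
  shows "oproj M x = y"
  unfolding oproj_def
  by (rule the_equality) (use assms orthogonal_projection_unique[OF assms(1)] in blast)+

lemma
  fixes M :: "'a::chilbert set"
  assumes "closed_csubspace M"
  shows oproj_in: "oproj M x \<in> M"
    and oproj_orthogonal: "z \<in> M \<Longrightarrow> inner (x - oproj M x) z = 0"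
proof -
  have M: "subspace M" "closed M" using assms by (auto simp: closed_csubspace_def csubspace_def)
  obtain y where y: "y \<in> M" "\<And>z. z \<in> M \<Longrightarrow> inner (x - y) z = 0"
    using orthogonal_projection_exists[OF M, of x] by metis
  with oproj_eqI[OF M(1)] show "oproj M x \<in> M" "z \<in> M \<Longrightarrow> inner (x - oproj M x) z = 0" by auto
qed

lemma oproj_id: "subspace M \<Longrightarrow> x \<in> M \<Longrightarrow> oproj M x = x"
  by (rule oproj_eqI) auto

lemma inner_oproj_left:
  fixes M :: "'a::chilbert set"
  assumes "closed_csubspace M" "z \<in> M"
  shows "inner (oproj M x) z = inner x z"
  using oproj_orthogonal[OF assms, of x] by (simp add: inner_diff_left)

lemma inner_oproj_swap:
  fixes M :: "'a::chilbert set"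
  assumes "closed_csubspace M"
  shows "inner (oproj M x) y = inner x (oproj M y)"
  using inner_oproj_left[OF assms oproj_in[OF assms], of x y] inner_oproj_left[OF assms oproj_in[OF assms], of y x]
  by (simp add: inner_commute)

lemma clinear_op_oproj:
  fixes M :: "'a::chilbert set"
  assumes M: "closed_csubspace M"
  shows "clinear_op (oproj M)"
proof -
  have sub: "subspace M" using M by (simp add: closed_csubspace_def csubspace_def)
  have im: "imult x \<in> M" if "x \<in> M" for x
    using M that by (auto simp: closed_csubspace_def csubspace_def)
  have "oproj M (x + y) = oproj M x + oproj M y" for x y
    by (rule oproj_eqI[OF sub])
      (use sub oproj_in[OF M] inner_oproj_left[OF M] in \<open>auto simp: subspace_add inner_diff_left inner_add_left\<close>)
  moreover have "oproj M (r *\<^sub>R x) = r *\<^sub>R oproj M x" for r x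
    by (rule oproj_eqI[OF sub])
      (use sub oproj_in[OF M] inner_oproj_left[OF M] in \<open>auto simp: subspace_scale inner_diff_left\<close>)
  moreover have "norm (oproj M x) \<le> norm x * 1" for x
  proof -
    have "(norm (oproj M x))\<^sup>2 = inner x (oproj M x)"
      using inner_oproj_left[OF M oproj_in[OF M], of x x] by (simp add: power2_norm_eq_inner)
    also have "\<dots> \<le> norm x * norm (oproj M x)" by (rule norm_cauchy_schwarz)
    finally show ?thesis
      by (cases "oproj M x = 0") (auto simp: power2_eq_square)
  qed
  moreover have "oproj M (imult x) = imult (oproj M x)" for x
    by (rule oproj_eqI[OF sub])
      (use im oproj_in[OF M] inner_oproj_left[OF M] in \<open>auto simp: inner_diff_left inner_imult_left\<close>)
  ultimately show ?thesis unfolding clinear_op_def by (blast intro: bounded_linear_intro)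
qed

text \<open>\<open>sub_adjoint\<close> is a choice and is determined only on \<open>K\<close>. The
  candidate \<open>S\<close> shows that the choice succeeds, and on \<open>K\<close> two adjoints
  differ by a vector of \<open>K\<close> orthogonal to \<open>K\<close>.\<close>

lemma sub_adjoint_eq:
  assumes K: "subspace K" and S: "\<And>x. x \<in> K \<Longrightarrow> S x \<in> K"
    "\<And>x y. x \<in> K \<Longrightarrow> y \<in> K \<Longrightarrow> inner (T x) y = inner x (S y)" and x: "x \<in> K"
  shows "sub_adjoint K T x = S x"
proof -
  have "(\<forall>x\<in>K. sub_adjoint K T x \<in> K) \<and>
      (\<forall>x\<in>K. \<forall>y\<in>K. inner (T x) y = inner x (sub_adjoint K T y))"
    unfolding sub_adjoint_def by (rule someI[of _ S]) (use S in blast)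
  then have "sub_adjoint K T x - S x \<in> K" "\<And>y. y \<in> K \<Longrightarrow> inner y (sub_adjoint K T x) = inner y (S x)"
    using S x K by (auto simp: subspace_diff)
  then have "inner (sub_adjoint K T x - S x) (sub_adjoint K T x - S x) = 0"
    unfolding inner_diff_right by simp
  then show ?thesis by simp
qed

lemma inner_imult_self [simp]: "inner (imult x) x = 0" "inner x (imult (x :: 'a::chilbert)) = 0"
  using inner_imult_left[of x x] by (simp_all add: inner_commute)

lemma norm_scaleC: "norm (scaleC c x) = cmod c * norm x"
proof -
  have "inner (scaleC c x) (scaleC c x) = ((Re c)\<^sup>2 + (Im c)\<^sup>2) * inner x x"
    by (simp add: scaleC_def inner_add_left inner_add_right imult_inner power2_eq_square algebra_simps)
  then have "(norm (scaleC c x))\<^sup>2 = (cmod c * norm x)\<^sup>2"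
    by (simp add: power2_norm_eq_inner[symmetric] power_mult_distrib cmod_power2)
  then show ?thesis by (simp add: power2_eq_iff_nonneg)
qed

lemma scaleC_scaleC: "scaleC c (scaleC d x) = scaleC (c * d) x"
  by (simp add: scaleC_def imult_add imult_scaleR imult_imult algebra_simps)

lemma bounded_linear_scaleC: "bounded_linear (\<lambda>c. scaleC c x)"
  by (rule bounded_linear_intro[of _ "norm x"]) (simp_all add: norm_scaleC, simp_all add: scaleC_def algebra_simps)

text \<open>The map \<open>c \<mapsto> scaleC c v\<close> multiplies norms by \<open>norm v\<close>,
  so its range is complete, hence closed.\<close>

lemma closed_csubspace_line:
  fixes v :: "'a::chilbert"
  assumes "v \<noteq> 0"
  shows "closed_csubspace (range (\<lambda>c. scaleC c v))"
proof -
  let ?f = "\<lambda>c. scaleC c v"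
  have "complete (range ?f)"
    by (rule complete_isometric_image[of "norm v"])
      (use assms in \<open>simp_all add: bounded_linear_scaleC norm_scaleC complete_UNIV\<close>)
  moreover have "subspace (range ?f)"
    by (intro linear_subspace_image bounded_linear.linear bounded_linear_scaleC subspace_UNIV)
  moreover have "imult (?f c) = ?f (\<i> * c)" for c
    by (simp add: scaleC_def imult_add imult_scaleR imult_imult)
  then have "imult ` range ?f \<subseteq> range ?f" by auto
  ultimately show ?thesis by (simp add: closed_csubspace_def csubspace_def complete_imp_closed)
qed

lemma cinner_scaleC_left: "cinner (scaleC c x) y = c * cinner x y"
  by (simp add: cinner_def scaleC_def complex_eq_iff inner_add_left imult_add imult_scaleR imult_imult
      algebra_simps)

lemma cinner_scaleC_right: "cinner x (scaleC c y) = cnj c * cinner x y"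
  by (simp add: cinner_def scaleC_def complex_eq_iff inner_add_right inner_imult_left imult_inner imult_imult
      algebra_simps)

section \<open>Cuntz families and their maximal commuting pieces\<close>

locale cuntz =
  fixes n :: nat and W :: "nat \<Rightarrow> 'h::chilbert \<Rightarrow> 'h"
  assumes cuntz: "cuntz_family n W"
begin

abbreviation "A i \<equiv> adjoint (W i)"

lemma clinear_W: "i < n \<Longrightarrow> clinear_op (W i)"
  using cuntz by (simp add: cuntz_family_def)

lemma A_W: "i < n \<Longrightarrow> j < n \<Longrightarrow> A i (W j x) = (if i = j then x else 0)"
  using cuntz by (simp add: cuntz_family_def)

lemma sum_W_A: "(\<Sum>i<n. W i (A i x)) = x"
  using cuntz by (simp add: cuntz_family_def)

lemma inner_W: "i < n \<Longrightarrow> inner (W i x) y = inner x (A i y)"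
  using clinear_W by (simp add: clinear_op_def adjoint_inner)

lemma sum_inner_A: "(\<Sum>i<n. inner (A i x) (A i y)) = inner x y"
proof -
  have "inner x y = inner (\<Sum>i<n. W i (A i x)) y" by (simp add: sum_W_A)
  also have "\<dots> = (\<Sum>i<n. inner (A i x) (A i y))"
    unfolding inner_sum_left by (rule sum.cong) (simp_all add: inner_W)
  finally show ?thesis by simp
qed

lemma clinear_A:
  assumes i: "i < n"
  shows "clinear_op (A i)"
proof -
  have ext: "u = v" if "\<And>x. inner x u = inner x v" for u v :: 'h
  proof -
    have "inner (u - v) (u - v) = 0" using that[of "u - v"] unfolding inner_diff_right by simp
    then show ?thesis by simp
  qed
  have W: "linear (W i)" "\<And>x. W i (imult x) = imult (W i x)"
    using clinear_W[OF i] by (auto simp: clinear_op_def bounded_linear.linear)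
  have "A i (x + y) = A i x + A i y" for x y
    by (rule ext) (simp add: inner_add_right inner_W[OF i, symmetric])
  moreover have "A i (r *\<^sub>R x) = r *\<^sub>R A i x" for r x
    by (rule ext) (simp add: inner_W[OF i, symmetric])
  moreover have "norm (A i x) \<le> norm x * 1" for x
  proof -
    have "inner (A i x) (A i x) \<le> (\<Sum>i<n. inner (A i x) (A i x))"
      using i by (intro member_le_sum) auto
    then have "(norm (A i x))\<^sup>2 \<le> (norm x)\<^sup>2" by (simp add: sum_inner_A power2_norm_eq_inner)
    then show ?thesis using power2_le_imp_le by auto
  qed
  moreover have "A i (imult x) = imult (A i x)" for x
  proof (rule ext)
    fix y
    have "inner y (A i (imult x)) = - inner (imult (W i y)) x"
      by (simp add: inner_W[OF i, symmetric] inner_imult_left)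
    also have "\<dots> = inner y (imult (A i x))"
      by (simp add: W(2)[symmetric] inner_W[OF i] inner_imult_left)
    finally show "inner y (A i (imult x)) = inner y (imult (A i x))" .
  qed
  ultimately show ?thesis unfolding clinear_op_def by (blast intro: bounded_linear_intro)
qed

lemma linear_A: "i < n \<Longrightarrow> linear (A i)"
  using clinear_A by (auto simp: clinear_op_def bounded_linear.linear)

text \<open>An explicit form of the space of the maximal commuting piece. Testing the commutators
  after every word in the \<open>A i\<close> builds in invariance under the \<open>A i\<close>, and
  it exhibits the space as an intersection of kernels, hence closed.\<close>

definition L :: "'h set" where
  "L = {h. \<forall>\<alpha>. set \<alpha> \<subseteq> {..<n} \<longrightarrow> (\<forall>i<n. \<forall>j<n. A i (A j (word A \<alpha> h)) = A j (A i (word A \<alpha> h)))}"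

lemma L_comm: "h \<in> L \<Longrightarrow> i < n \<Longrightarrow> j < n \<Longrightarrow> A i (A j h) = A j (A i h)"
  unfolding L_def by (drule CollectD, drule spec[of _ "[]"]) simp

lemma L_A:
  assumes "h \<in> L" "k < n"
  shows "A k h \<in> L"
  unfolding L_def
proof (intro CollectI allI impI)
  fix \<alpha> i j assume "set \<alpha> \<subseteq> {..<n}" "i < n" "j < n"
  then have "A i (A j (word A (\<alpha> @ [k]) h)) = A j (A i (word A (\<alpha> @ [k]) h))"
    using assms unfolding L_def by auto
  then show "A i (A j (word A \<alpha> (A k h))) = A j (A i (word A \<alpha> (A k h)))"
    by (simp add: word_append)
qed

lemma closed_csubspace_L: "closed_csubspace L"
proof -
  let ?T = "\<lambda>\<alpha> i j h. A i (A j (word A \<alpha> h)) - A j (A i (word A \<alpha> h))"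
  have "clinear_op (?T \<alpha> i j)" if "set \<alpha> \<subseteq> {..<n}" "i < n" "j < n" for \<alpha> i j
  proof -
    have w: "clinear_op (word A \<alpha>)" using that by (auto intro!: clinear_op_word clinear_A)
    have "clinear_op (A i \<circ> (A j \<circ> word A \<alpha>))" "clinear_op (A j \<circ> (A i \<circ> word A \<alpha>))"
      using that by (auto intro!: clinear_op_compose clinear_A w)
    then show ?thesis
      using linear_diff[OF bounded_linear.linear[OF bounded_linear_imult], symmetric]
      by (auto simp: clinear_op_def comp_def intro: bounded_linear_sub)
  qed
  then have "closed_csubspace M"
    if "M \<in> {{h. ?T \<alpha> i j h = 0} | \<alpha> i j. set \<alpha> \<subseteq> {..<n} \<and> i < n \<and> j < n}" for M
    using that closed_csubspace_kernel by blast
  moreover have "L = \<Inter>{{h. ?T \<alpha> i j h = 0} | \<alpha> i j. set \<alpha> \<subseteq> {..<n} \<and> i < n \<and> j < n}"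
    unfolding L_def by auto
  ultimately show ?thesis by (simp only: closed_csubspace_Inter)
qed

text \<open>On such a \<open>K\<close> the operator \<open>sub_adjoint K (W i)\<close> is just
  \<open>A i\<close>. A competitor \<open>M\<close> lies in \<open>L\<close> because words in the
  \<open>A i\<close> keep \<open>M\<close> invariant and the \<open>A i\<close> commute on it. In
  particular the maximum selected by \<open>GREATEST\<close> exists.\<close>

lemma comm_space_eq:
  assumes K: "closed_csubspace K" "\<And>i x. i < n \<Longrightarrow> x \<in> K \<Longrightarrow> A i x \<in> K"
  shows "comm_space n W K = L \<inter> K"
proof -
  have sub: "sub_adjoint K (W i) x = A i x" if "i < n" "x \<in> K" for i x
    using K that by (intro sub_adjoint_eq) (auto simp: closed_csubspace_def csubspace_def inner_W)
  show ?thesis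
    unfolding comm_space_def
  proof (rule Greatest_equality)
    show "comm_inv n W K (L \<inter> K)"
      unfolding comm_inv_def
      using K closed_csubspace_Int[OF closed_csubspace_L K(1)] by (auto simp: sub L_A L_comm)
  next
    fix M assume M: "comm_inv n W K M"
    then have MK: "M \<subseteq> K" by (simp add: comm_inv_def)
    have MA: "A i h \<in> M" if "i < n" "h \<in> M" for i h
    proof -
      have "sub_adjoint K (W i) h \<in> M" using M that by (auto simp: comm_inv_def)
      then show ?thesis using sub that MK by auto
    qed
    have Mc: "A i (A j h) = A j (A i h)" if "i < n" "j < n" "h \<in> M" for i j h
    proof -
      have "sub_adjoint K (W i) (sub_adjoint K (W j) h) = sub_adjoint K (W j) (sub_adjoint K (W i) h)"
        using M that by (simp add: comm_inv_def)
      moreover have "h \<in> K" using that MK by auto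
      ultimately show ?thesis using that K(2) by (simp add: sub)
    qed
    have "h \<in> L" if "h \<in> M" for h
      unfolding L_def
    proof (intro CollectI allI impI)
      fix \<alpha> i j assume "set \<alpha> \<subseteq> {..<n}" "i < n" "j < n"
      moreover from this have "word A \<alpha> h \<in> M" using MA that by (intro word_in) auto
      ultimately show "A i (A j (word A \<alpha> h)) = A j (A i (word A \<alpha> h))" using Mc by blast
    qed
    then show "M \<le> L \<inter> K" using MK by auto
  qed
qed

lemma comm_space_UNIV: "comm_space n W UNIV = L"
  using comm_space_eq[of UNIV] by (simp add: closed_csubspace_def csubspace_def)

section \<open>Generated reducing subspaces and the spherical decomposition\<close>

definition G :: "'h set \<Rightarrow> 'h set" where
  "G D = closure (cspan {word W \<alpha> h | \<alpha> h. set \<alpha> \<subseteq> {..<n} \<and> h \<in> D})"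

lemma closed_csubspace_G: "closed_csubspace (G D)"
  unfolding G_def by (intro closed_csubspace_closure csubspace_cspan)

lemma word_in_G: "set \<alpha> \<subseteq> {..<n} \<Longrightarrow> h \<in> D \<Longrightarrow> word W \<alpha> h \<in> G D"
  unfolding G_def by (rule subsetD[OF closure_cspan_superset]) auto

lemma G_superset: "D \<subseteq> G D"
  using word_in_G[of "[]"] by auto

text \<open>Applied to a nonempty word, \<open>A i\<close> cancels its first letter or gives 0; on
  the empty word the invariance of \<open>D\<close> takes over. So \<open>G D\<close> is the
  reducing subspace generated by \<open>D\<close>.\<close>

lemma reducing_G:
  assumes "\<And>i h. i < n \<Longrightarrow> h \<in> D \<Longrightarrow> A i h \<in> D"
  shows "reducing n W (G D)"
proof -
  have "W i x \<in> G D" if "i < n" "x \<in> G D" for i x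
    using that(2) unfolding G_def
    by (rule clinear_op_closure_cspan[OF clinear_W[OF that(1)] closed_csubspace_G[unfolded G_def], rotated])
      (use word_in_G[of "i # _"] that(1) in \<open>auto simp: G_def\<close>)
  moreover have "A i x \<in> G D" if "i < n" "x \<in> G D" for i x
    using that(2) unfolding G_def
  proof (rule clinear_op_closure_cspan[OF clinear_A[OF that(1)] closed_csubspace_G[unfolded G_def], rotated])
    fix y assume "y \<in> {word W \<alpha> h | \<alpha> h. set \<alpha> \<subseteq> {..<n} \<and> h \<in> D}"
    then obtain \<alpha> h where y: "y = word W \<alpha> h" "set \<alpha> \<subseteq> {..<n}" "h \<in> D" by auto
    have "0 \<in> G D" using closed_csubspace_G by (simp add: closed_csubspace_def csubspace_def subspace_0)
    then have "A i y \<in> G D"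
      using y that(1) assms G_superset word_in_G by (cases \<alpha>) (auto simp: A_W)
    then show "A i y \<in> closure (cspan {word W \<alpha> h | \<alpha> h. set \<alpha> \<subseteq> {..<n} \<and> h \<in> D})"
      by (simp add: G_def)
  qed
  ultimately show ?thesis unfolding reducing_def using closed_csubspace_G by auto
qed

lemma reducing_orthogonal_comp:
  assumes K: "reducing n W K"
  shows "reducing n W (orthogonal_comp K)"
proof -
  have "W i x \<in> orthogonal_comp K" "A i x \<in> orthogonal_comp K"
    if i: "i < n" and x: "x \<in> orthogonal_comp K" for i x
  proof -
    have "inner y (W i x) = 0" if "y \<in> K" for y
    proof -
      have "inner y (W i x) = inner (A i y) x"
        using inner_W[OF i, of x y] by (simp add: inner_commute)
      moreover have "A i y \<in> K" using K that i by (auto simp: reducing_def)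
      ultimately show ?thesis using x by (simp add: orthogonal_comp_iff)
    qed
    moreover have "inner y (A i x) = 0" if "y \<in> K" for y
      using K that i x by (auto simp: inner_W[symmetric] reducing_def orthogonal_comp_iff)
    ultimately show "W i x \<in> orthogonal_comp K" "A i x \<in> orthogonal_comp K"
      by (auto simp: orthogonal_comp_iff)
  qed
  then show ?thesis using K closed_csubspace_orthogonal_comp by (auto simp: reducing_def)
qed

lemma comm_space_reducing: "reducing n W K \<Longrightarrow> comm_space n W K = L \<inter> K"
  by (rule comm_space_eq) (auto simp: reducing_def)

text \<open>Split \<open>h\<close> in \<open>L\<close> along \<open>K\<close> and its complement.
  Both summands are reducing, so each commutator sends the components to orthogonal subspaces; since
  the images add up to 0, both vanish. Thus the component in the complement lies in \<open>L\<close>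
  and is 0 by \<open>triv\<close>.\<close>

lemma L_subset_reducing:
  assumes K: "reducing n W K" and triv: "L \<inter> orthogonal_comp K = {0}"
  shows "L \<subseteq> K"
proof
  fix h assume h: "h \<in> L"
  have Kc: "closed_csubspace K" using K by (simp add: reducing_def)
  have K': "reducing n W (orthogonal_comp K)" by (rule reducing_orthogonal_comp[OF K])
  obtain y where y: "y \<in> K" "h - y \<in> orthogonal_comp K" using orthogonal_decomposition[OF Kc] .
  have "h - y \<in> L"
    unfolding L_def
  proof (intro CollectI allI impI)
    fix \<alpha> i j assume a: "set \<alpha> \<subseteq> {..<n}" "i < n" "j < n"
    let ?T = "\<lambda>h. A i (A j (word A \<alpha> h)) - A j (A i (word A \<alpha> h))"
    have A_in: "A i x \<in> N" if "reducing n W N" "x \<in> N" "i < n" for i x N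
      using that by (auto simp: reducing_def)
    have in_N: "?T x \<in> N" if N: "reducing n W N" and "x \<in> N" for x N
    proof -
      have "word A \<alpha> x \<in> N" using a that by (intro word_in) (auto intro: A_in)
      moreover have "subspace N" using N by (simp add: reducing_def closed_csubspace_def csubspace_def)
      ultimately show ?thesis using a A_in[OF N] by (simp add: subspace_diff)
    qed
    have w: "linear (word A \<alpha>)"
    proof -
      have "clinear_op (word A \<alpha>)" using a by (intro clinear_op_word clinear_A) auto
      then show ?thesis by (simp add: clinear_op_def bounded_linear.linear)
    qed
    have "?T h = 0" using h a unfolding L_def by simp
    then have "?T y = - ?T (h - y)"
      using a by (simp add: linear_diff[OF w] linear_diff[OF linear_A])
    moreover have "- ?T (h - y) \<in> orthogonal_comp K"
      by (intro subspace_neg subspace_orthogonal_comp in_N K' y)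
    ultimately have "?T y = 0"
      using in_N[OF K y(1)] by (metis orthogonal_comp_Int)
    with \<open>?T y = - ?T (h - y)\<close> show "A i (A j (word A \<alpha> (h - y))) = A j (A i (word A \<alpha> (h - y)))"
      by simp
  qed
  then have "h - y \<in> {0}" using y(2) triv by blast
  then show "h \<in> K" using y by simp
qed

text \<open>\<open>G L\<close> is a solution: it contains \<open>L\<close>, so nothing of
  \<open>L\<close> is left in the complement. For any solution \<open>K\<close>, triviality on the
  complement forces \<open>L \<subseteq> K\<close>, so the commuting space of \<open>K\<close> is
  all of \<open>L\<close>, and sphericity reads \<open>K = G L\<close>.\<close>

theorem unique_spherical_decomposition:
  "\<exists>!K0. reducing n W K0 \<and> reducing n W (orthogonal_comp K0) \<and>
      spherical n W K0 \<and> trivial_comm n W (orthogonal_comp K0)"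
proof (rule ex1I)
  have red: "reducing n W (G L)" using L_A by (rule reducing_G)
  note red' = reducing_orthogonal_comp[OF red]
  have "L \<inter> G L = L" using G_superset by auto
  then have "spherical n W (G L)"
    unfolding spherical_def comm_space_reducing[OF red] by (simp only: G_def[symmetric])
  moreover have "L \<inter> orthogonal_comp (G L) = {0}"
  proof -
    have "0 \<in> L" using closed_csubspace_L by (simp add: closed_csubspace_def csubspace_def subspace_0)
    moreover have "0 \<in> orthogonal_comp (G L)" by (simp add: orthogonal_comp_iff)
    ultimately show ?thesis using G_superset[of L] orthogonal_comp_Int[of _ "G L"] by blast
  qed
  ultimately show "reducing n W (G L) \<and> reducing n W (orthogonal_comp (G L)) \<and>
      spherical n W (G L) \<and> trivial_comm n W (orthogonal_comp (G L))"
    using red red' unfolding trivial_comm_def comm_space_reducing[OF red'] by blast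
next
  fix K assume K: "reducing n W K \<and> reducing n W (orthogonal_comp K) \<and>
      spherical n W K \<and> trivial_comm n W (orthogonal_comp K)"
  then have "L \<inter> orthogonal_comp K = {0}"
    unfolding trivial_comm_def using comm_space_reducing by metis
  then have "L \<subseteq> K" using K L_subset_reducing by blast
  then have "L \<inter> K = L" by auto
  then have "comm_space n W K = L" using K comm_space_reducing by metis
  then show "K = G L" using K by (simp add: spherical_def G_def)
qed

section \<open>Cesaro means and the adjoints of the \<open>A i\<close> on \<open>L\<close>\<close>

text \<open>The vectors \<open>v k\<close> of the introduction, written as iterates of the map
  \<open>X \<mapsto> (\<Sum>j<n. W j \<circ> X \<circ> A j)\<close> applied to \<open>W i\<close>.\<close>

primrec W_iter :: "nat \<Rightarrow> nat \<Rightarrow> 'h \<Rightarrow> 'h" where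
  "W_iter i 0 h = W i h"
| "W_iter i (Suc k) h = (\<Sum>j<n. W j (W_iter i k (A j h)))"

lemma A_W_iter_Suc: "j < n \<Longrightarrow> A j (W_iter i (Suc k) h) = W_iter i k (A j h)"
  by (simp add: linear_sum[OF linear_A] A_W sum.delta')

text \<open>As seen from \<open>L\<close>, all iterates look alike: expand the inner product over
  the letters, lower the index by the shift, move \<open>A i\<close> past \<open>A j\<close> by
  commutativity, and sum up again.\<close>

lemma inner_W_iter:
  assumes "i < n"
  shows "g \<in> L \<Longrightarrow> h \<in> L \<Longrightarrow> inner g (W_iter i k h) = inner (A i g) h"
proof (induct k arbitrary: g h)
  case 0
  then show ?case using inner_W[OF assms, of h g] by (simp add: inner_commute)
next
  case (Suc k)
  have "inner g (W_iter i (Suc k) h) = (\<Sum>j<n. inner (A j g) (A j (W_iter i (Suc k) h)))"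
    by (simp only: sum_inner_A)
  also have "\<dots> = (\<Sum>j<n. inner (A j (A i g)) (A j h))"
    by (rule sum.cong) (use Suc assms in \<open>auto simp del: W_iter.simps simp: A_W_iter_Suc L_A L_comm\<close>)
  finally show ?case by (simp only: sum_inner_A)
qed

text \<open>Expanding over the letters lowers both indices by one, which reduces to the case that
  one of them is 0. There \<open>W i\<close> moves to the other side as \<open>A i\<close>, shifts
  the second iterate, and \<open>inner_W_iter\<close> evaluates the result
  (\<open>off\<close>).\<close>

lemma gram_W_iter:
  assumes i: "i < n"
  shows "h \<in> L \<Longrightarrow>
    inner (W_iter i k h) (W_iter i l h) = (if k = l then inner h h else inner (A i h) (A i h))"
proof (induct k arbitrary: h l)
  have off: "inner (W_iter i 0 h) (W_iter i (Suc m) h) = inner (A i h) (A i h)" if "h \<in> L" for h m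
  proof -
    have "inner (W_iter i 0 h) (W_iter i (Suc m) h) = inner h (A i (W_iter i (Suc m) h))"
      using i by (simp only: W_iter.simps(1) inner_W)
    also have "\<dots> = inner (A i h) (A i h)"
      using i that by (simp only: A_W_iter_Suc inner_W_iter L_A)
    finally show ?thesis .
  qed
  {
    case 0
    then show ?case using i off[of h] by (cases l) (simp_all del: W_iter.simps(2) add: inner_W A_W)
  next
    case (Suc k)
    show ?case
    proof (cases l)
      case 0
      then show ?thesis using off[of h k] Suc.prems inner_commute[of "W_iter i 0 h" "W_iter i (Suc k) h"]
        by (simp del: W_iter.simps)
    next
      case (Suc m)
      have "inner (W_iter i (Suc k) h) (W_iter i (Suc m) h)
          = (\<Sum>j<n. inner (W_iter i k (A j h)) (W_iter i m (A j h)))"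
        unfolding sum_inner_A[of "W_iter i (Suc k) h", symmetric]
        by (rule sum.cong) (auto simp del: W_iter.simps simp: A_W_iter_Suc)
      also have "\<dots> = (\<Sum>j<n. if k = m then inner (A j h) (A j h) else inner (A j (A i h)) (A j (A i h)))"
        by (rule sum.cong) (use Suc.hyps Suc.prems i in \<open>auto simp: L_A L_comm\<close>)
      also have "\<dots> = (if Suc k = l then inner h h else inner (A i h) (A i h))"
        using Suc by (simp add: sum_inner_A)
      finally show ?thesis using Suc by simp
    qed
  }
qed

definition U :: "nat \<Rightarrow> 'h \<Rightarrow> 'h" where
  "U i h = lim (\<lambda>p. inverse (real (Suc p)) *\<^sub>R (\<Sum>k<Suc p. W_iter i k h))"

lemma
  assumes "i < n" "h \<in> L"
  shows U_lim: "(\<lambda>p. inverse (real (Suc p)) *\<^sub>R (\<Sum>k<Suc p. W_iter i k h)) \<longlonglongrightarrow> U i h"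
    and U_lim_Suc: "(\<lambda>p. inverse (real (Suc p)) *\<^sub>R (\<Sum>k<Suc p. W_iter i (Suc k) h)) \<longlonglongrightarrow> U i h"
proof -
  obtain u where u: "(\<lambda>p. inverse (real (Suc p)) *\<^sub>R (\<Sum>k<Suc p. W_iter i k h)) \<longlonglongrightarrow> u"
    "(\<lambda>p. inverse (real (Suc p)) *\<^sub>R (\<Sum>k<Suc p. W_iter i (Suc k) h)) \<longlonglongrightarrow> u"
    using cesaro_convergent_of_constant_gram[of "\<lambda>k. W_iter i k h", OF gram_W_iter[OF assms]] .
  have "U i h = u" unfolding U_def using u(1) by (rule limI)
  with u show "(\<lambda>p. inverse (real (Suc p)) *\<^sub>R (\<Sum>k<Suc p. W_iter i k h)) \<longlonglongrightarrow> U i h"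
    "(\<lambda>p. inverse (real (Suc p)) *\<^sub>R (\<Sum>k<Suc p. W_iter i (Suc k) h)) \<longlonglongrightarrow> U i h"
    by simp_all
qed

lemma A_U:
  assumes i: "i < n" and j: "j < n" and h: "h \<in> L"
  shows "A j (U i h) = U i (A j h)"
proof -
  have bl: "bounded_linear (A j)" using clinear_A[OF j] by (simp add: clinear_op_def)
  \<comment> \<open>The means starting at index 1 are used because \<open>A j\<close> shifts only
    iterates with a successor index; its effect on \<open>W_iter i 0 h\<close> is different.\<close>
  have "(\<lambda>p. A j (inverse (real (Suc p)) *\<^sub>R (\<Sum>k<Suc p. W_iter i (Suc k) h))) \<longlonglongrightarrow> A j (U i h)"
    by (rule bounded_linear.tendsto[OF bl U_lim_Suc[OF i h]])
  moreover have "A j (inverse (real (Suc p)) *\<^sub>R (\<Sum>k<Suc p. W_iter i (Suc k) h))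
      = inverse (real (Suc p)) *\<^sub>R (\<Sum>k<Suc p. W_iter i k (A j h))" for p
    unfolding linear_scale[OF linear_A[OF j]] linear_sum[OF linear_A[OF j]] A_W_iter_Suc[OF j] ..
  ultimately have "(\<lambda>p. inverse (real (Suc p)) *\<^sub>R (\<Sum>k<Suc p. W_iter i k (A j h))) \<longlonglongrightarrow> A j (U i h)"
    by simp
  then show ?thesis using LIMSEQ_unique U_lim[OF i L_A[OF h j]] by blast
qed

text \<open>All words in the \<open>A j\<close> pass through \<open>U i\<close>, so the commutation
  relations at \<open>h\<close> carry over to \<open>U i h\<close>; these relations define
  \<open>L\<close>.\<close>

lemma U_in_L:
  assumes i: "i < n" and h: "h \<in> L"
  shows "U i h \<in> L"
  unfolding L_def
proof (intro CollectI allI impI)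
  fix \<alpha> j k assume a: "set \<alpha> \<subseteq> {..<n}" and jk: "j < n" "k < n"
  have "word A \<alpha> (U i h) = U i (word A \<alpha> h) \<and> word A \<alpha> h \<in> L"
    using a by (induct \<alpha>) (auto simp: h A_U[OF i] L_A)
  then show "A j (A k (word A \<alpha> (U i h))) = A k (A j (word A \<alpha> (U i h)))"
    using jk i by (simp add: A_U L_A L_comm)
qed

text \<open>By \<open>inner_W_iter\<close> every mean has the same inner product with
  \<open>g\<close>, so the limit has it as well.\<close>

lemma inner_U:
  assumes i: "i < n" and "g \<in> L" "h \<in> L"
  shows "inner g (U i h) = inner (A i g) h"
proof -
  have "(\<lambda>p. inner g (inverse (real (Suc p)) *\<^sub>R (\<Sum>k<Suc p. W_iter i k h))) \<longlonglongrightarrow> inner g (U i h)"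
    by (intro tendsto_intros U_lim assms)
  moreover have "inner g (inverse (real (Suc p)) *\<^sub>R (\<Sum>k<Suc p. W_iter i k h)) = inner (A i g) h" for p
    unfolding inner_scaleR_right inner_sum_right inner_W_iter[OF assms] by simp
  ultimately have "(\<lambda>p. inner (A i g) h) \<longlonglongrightarrow> inner g (U i h)" by simp
  then show ?thesis by (simp add: LIMSEQ_const_iff)
qed

section \<open>The maximal commuting piece as a spherical unitary\<close>

lemma subspace_L: "subspace L"
  using closed_csubspace_L by (simp add: closed_csubspace_def csubspace_def)

abbreviation "Z i \<equiv> max_comm_piece n W UNIV i"

lemma Z_eq: "Z i x = oproj L (W i x)"
  by (simp add: max_comm_piece_def comm_space_UNIV)

lemma Z_eq_U:
  assumes "i < n" "h \<in> L"
  shows "Z i h = U i h"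
  unfolding Z_eq
proof (rule oproj_eqI[OF subspace_L U_in_L[OF assms]])
  fix z assume "z \<in> L"
  then show "inner (W i h - U i h) z = 0"
    using assms inner_U[of i z h] inner_commute[of "U i h" z] inner_commute[of h "A i z"]
    by (simp add: inner_diff_left inner_W)
qed

lemma Z_in_L: "i < n \<Longrightarrow> h \<in> L \<Longrightarrow> Z i h \<in> L"
  by (simp add: Z_eq_U U_in_L)

lemma inner_Z: "i < n \<Longrightarrow> x \<in> L \<Longrightarrow> y \<in> L \<Longrightarrow> inner (Z i x) y = inner x (A i y)"
  using inner_U[of i y x] by (simp add: Z_eq_U inner_commute)

text \<open>For \<open>i = j\<close> this is normality of the compression; for
  \<open>i \<noteq> j\<close> it is the commutation that Fuglede's theorem would give, obtained here
  directly from the means.\<close>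

lemma A_Z: "i < n \<Longrightarrow> j < n \<Longrightarrow> h \<in> L \<Longrightarrow> A j (Z i h) = Z i (A j h)"
  by (simp add: Z_eq_U A_U L_A)

lemma Z_Z:
  assumes "i < n" "j < n" "h \<in> L"
  shows "Z i (Z j h) = Z j (Z i h)"
proof -
  let ?d = "Z i (Z j h) - Z j (Z i h)"
  have d: "?d \<in> L" using assms by (simp add: Z_in_L subspace_diff subspace_L)
  then have "inner ?d ?d = 0"
    using assms unfolding inner_diff_left[of _ _ ?d] by (simp add: inner_Z Z_in_L L_A L_comm)
  then show ?thesis by simp
qed

lemma sum_Z_A:
  assumes "x \<in> L"
  shows "(\<Sum>i<n. Z i (A i x)) = x"
proof -
  have "linear (oproj L)"
    using clinear_op_oproj[OF closed_csubspace_L] by (simp add: clinear_op_def bounded_linear.linear)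
  then have "(\<Sum>i<n. Z i (A i x)) = oproj L (\<Sum>i<n. W i (A i x))"
    by (simp add: Z_eq linear_sum)
  then show ?thesis using assms by (simp add: sum_W_A oproj_id subspace_L)
qed

text \<open>Inside \<open>L\<close> the adjoint of \<open>Z i\<close> is the restriction of
  \<open>A i\<close>, so normality is \<open>A_Z\<close> and the sphere relation is the compression
  of the Cuntz relation.\<close>

theorem spherical_unitary_max_comm_piece:
  "spherical_unitary_on n (comm_space n W UNIV) (max_comm_piece n W UNIV)"
proof -
  have "sub_adjoint L (Z i) x = A i x" if "i < n" "x \<in> L" for i x
    using that by (intro sub_adjoint_eq subspace_L) (auto simp: L_A inner_Z)
  then show ?thesis
    unfolding spherical_unitary_on_def comm_space_UNIV
    by (auto simp: Z_in_L Z_Z A_Z sum_Z_A)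
qed

text \<open>If \<open>D \<noteq> L\<close>, then \<open>?E\<close>, the part of \<open>L\<close>
  orthogonal to \<open>D\<close>, is nonzero. Invariance of \<open>D\<close> under the
  \<open>Z i\<close> makes \<open>?E\<close> invariant under the \<open>A i\<close>, so the
  complement of \<open>?E\<close> is invariant under the \<open>W i\<close> and contains
  \<open>G D\<close>. Thus \<open>G D\<close> is a proper reducing subspace, hence zero.\<close>

lemma irreducible_L:
  assumes irr: "irreducible_rep n W"
    and D: "closed_csubspace D" "D \<subseteq> L" "\<And>i x. i < n \<Longrightarrow> x \<in> D \<Longrightarrow> A i x \<in> D"
      "\<And>i x. i < n \<Longrightarrow> x \<in> D \<Longrightarrow> Z i x \<in> D"
  shows "D = {0} \<or> D = L"
proof (rule disjCI)
  assume "D \<noteq> L"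
  then obtain x where x: "x \<in> L" "x \<notin> D" using D(2) by blast
  obtain d where d: "d \<in> D" "x - d \<in> orthogonal_comp D" using orthogonal_decomposition[OF D(1)] .
  let ?E = "L \<inter> orthogonal_comp D"
  have E: "closed_csubspace ?E"
    by (intro closed_csubspace_Int closed_csubspace_L closed_csubspace_orthogonal_comp D)
  have AE: "A i e \<in> ?E" if "i < n" "e \<in> ?E" for i e
  proof -
    have "inner y (A i e) = 0" if "y \<in> D" for y
    proof -
      have "inner y (A i e) = inner (Z i y) e"
        using \<open>i < n\<close> \<open>e \<in> ?E\<close> D(2) that by (subst inner_Z) auto
      then show ?thesis using \<open>e \<in> ?E\<close> D(4)[OF \<open>i < n\<close> that] by (simp add: orthogonal_comp_iff)
    qed
    then show ?thesis using that L_A by (simp add: orthogonal_comp_iff)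
  qed
  have WE: "W i y \<in> orthogonal_comp ?E" if "i < n" "y \<in> orthogonal_comp ?E" for i y
  proof -
    have "inner e (W i y) = 0" if "e \<in> ?E" for e
    proof -
      have "inner e (W i y) = inner (A i e) y"
        using inner_W[OF \<open>i < n\<close>, of y e] by (simp add: inner_commute)
      also have "\<dots> = 0"
        using \<open>y \<in> orthogonal_comp ?E\<close> AE[OF \<open>i < n\<close> that] unfolding orthogonal_comp_iff[of y] by blast
      finally show ?thesis .
    qed
    then show ?thesis unfolding orthogonal_comp_iff[of "W i y"] by blast
  qed
  have "inner e y = 0" if "y \<in> D" "e \<in> ?E" for y e
    using that inner_commute[of e y] by (simp add: orthogonal_comp_iff)
  then have "D \<subseteq> orthogonal_comp ?E" unfolding subset_iff orthogonal_comp_iff[of _ ?E] by blast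
  then have "G D \<subseteq> orthogonal_comp ?E"
    unfolding G_def
    by (intro closure_cspan_least closed_csubspace_orthogonal_comp E) (auto intro!: word_in WE)
  moreover have "x - d \<in> ?E" using d x D(2) by (auto intro: subspace_diff subspace_L)
  moreover have "x - d \<noteq> 0" using d x by auto
  ultimately have "G D \<noteq> UNIV" using orthogonal_comp_Int[of "x - d" ?E] by blast
  moreover have "reducing n W (G D)" using D(3) by (rule reducing_G)
  ultimately have "G D = {0}" using irr unfolding irreducible_rep_def by blast
  then show "D = {0}"
    using G_superset[of D] D(1) by (auto simp: closed_csubspace_def csubspace_def dest: subspace_0)
qed

section \<open>Irreducible representations\<close>

abbreviation "P \<equiv> oproj L"

lemma P_in: "P x \<in> L" by (rule oproj_in[OF closed_csubspace_L])
lemma P_id: "x \<in> L \<Longrightarrow> P x = x" by (rule oproj_id[OF subspace_L])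
lemma clinear_P: "clinear_op P" by (rule clinear_op_oproj[OF closed_csubspace_L])

lemma imult_in_L: "x \<in> L \<Longrightarrow> imult x \<in> L"
  using closed_csubspace_L by (auto simp: closed_csubspace_def csubspace_def)

text \<open>Extensions by 0 on the complement of \<open>L\<close>: they are bounded operators on the
  whole space, as \<open>selfadjoint_schur\<close> requires, and still adjoint to each other and
  commuting.\<close>

definition Z' :: "nat \<Rightarrow> 'h \<Rightarrow> 'h" where "Z' i x = Z i (P x)"
definition A' :: "nat \<Rightarrow> 'h \<Rightarrow> 'h" where "A' i x = A i (P x)"

lemma clinear_Z': "i < n \<Longrightarrow> clinear_op (Z' i)"
  using clinear_op_compose[OF clinear_P clinear_op_compose[OF clinear_W clinear_P]]
  by (simp add: Z'_def[abs_def] Z_eq comp_def)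

lemma clinear_A': "i < n \<Longrightarrow> clinear_op (A' i)"
  using clinear_op_compose[OF clinear_A clinear_P] by (simp add: A'_def[abs_def] comp_def)

lemma Z'_in: "i < n \<Longrightarrow> Z' i x \<in> L" and A'_in: "i < n \<Longrightarrow> A' i x \<in> L"
  by (simp_all add: Z'_def A'_def Z_in_L L_A P_in)

lemma P_commute: "i < n \<Longrightarrow> P (Z' i x) = Z' i (P x)" "i < n \<Longrightarrow> P (A' i x) = A' i (P x)"
  by (simp_all add: P_id Z'_in A'_in) (simp_all add: Z'_def A'_def P_id P_in)

lemma inner_Z':
  assumes "i < n"
  shows "inner (Z' i x) y = inner x (A' i y)"
proof -
  have "inner (Z' i x) y = inner (Z' i x) (P y)"
    using inner_oproj_swap[OF closed_csubspace_L, of "Z' i x" y] assms by (simp add: P_id Z'_in)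
  also have "\<dots> = inner (P x) (A' i y)" using assms by (simp add: Z'_def A'_def inner_Z P_in)
  also have "\<dots> = inner x (A' i y)"
    using inner_oproj_swap[OF closed_csubspace_L, of x "A' i y"] assms by (simp add: P_id A'_in)
  finally show ?thesis .
qed

text \<open>Including \<open>imult\<close> turns the real invariant subspaces of
  \<open>selfadjoint_schur\<close> into complex ones, to which \<open>irreducible_L\<close>
  applies.\<close>

definition \<R> :: "('h \<Rightarrow> 'h) set" where
  "\<R> = {imult} \<union> Z' ` {..<n} \<union> A' ` {..<n}"

lemma \<R>_bounded_linear: "R \<in> \<R> \<Longrightarrow> bounded_linear R"
  using clinear_Z' clinear_A' bounded_linear_imult by (auto simp: \<R>_def clinear_op_def)

lemma \<R>_in_L: "R \<in> \<R> \<Longrightarrow> x \<in> L \<Longrightarrow> R x \<in> L"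
  by (auto simp: \<R>_def Z'_in A'_in imult_in_L)

lemma \<R>_commute: "R \<in> \<R> \<Longrightarrow> Q \<in> \<R> \<Longrightarrow> R (Q x) = Q (R x)"
  using clinear_Z' clinear_A'
  by (auto simp: \<R>_def clinear_op_def)
    (simp_all add: Z'_def A'_def P_id P_in Z_in_L L_A A_Z Z_Z L_comm)

lemma selfadjoint_commutant_scalar:
  assumes irr: "irreducible_rep n W"
    and T: "bounded_linear T" "\<And>x y. inner (T x) y = inner x (T y)" "\<And>x. P (T x) = T (P x)"
    and comm: "\<And>R x. R \<in> \<R> \<Longrightarrow> R (T x) = T (R x)"
  shows "\<exists>c. \<forall>x\<in>L. T x = c *\<^sub>R x"
proof (rule selfadjoint_schur[OF T(1,2), where P = P and \<R> = \<R>])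
  show "bounded_linear P" using clinear_P by (simp add: clinear_op_def)
  show "closed L" using closed_csubspace_L by (simp add: closed_csubspace_def)
  fix D assume D: "subspace D" "closed D" "D \<subseteq> L" "\<And>R x. R \<in> \<R> \<Longrightarrow> x \<in> D \<Longrightarrow> R x \<in> D"
  have Z: "Z i x \<in> D" and A: "A i x \<in> D" if "i < n" "x \<in> D" for i x
  proof -
    have "Z' i \<in> \<R>" "A' i \<in> \<R>" using that by (auto simp: \<R>_def)
    then have "Z' i x \<in> D" "A' i x \<in> D" using D(4) that(2) by blast+
    moreover have "P x = x" using that D(3) by (auto intro: P_id)
    ultimately show "Z i x \<in> D" "A i x \<in> D" by (simp_all add: Z'_def A'_def)
  qed
  have "imult \<in> \<R>" by (simp add: \<R>_def)
  then have "imult ` D \<subseteq> D" using D(4) by blast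
  then have "closed_csubspace D" using D(1,2) by (simp add: closed_csubspace_def csubspace_def)
  then show "D = {0} \<or> D = L" using irreducible_L[OF irr _ D(3)] Z A by blast
qed (auto simp: P_in P_id T(3) subspace_L \<R>_bounded_linear comm \<R>_in_L)

text \<open>The sum \<open>Z' i + A' i\<close> and \<open>imult\<close> applied to the difference
  \<open>Z' i - A' i\<close> are self-adjoint for the real inner product and commute with the
  family, so they are real scalars \<open>a\<close> and \<open>b\<close> on \<open>L\<close>.
  Solving for the two operators gives the eigenvalue with real part \<open>a/2\<close> and imaginary
  part \<open>-b/2\<close>.\<close>

lemma irreducible_eigenvalue:
  assumes irr: "irreducible_rep n W" and i: "i < n"
  shows "\<exists>w. \<forall>x\<in>L. A i x = scaleC (cnj w) x \<and> Z i x = scaleC w x"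
proof -
  let ?R = "\<lambda>x. Z' i x + A' i x" and ?I = "\<lambda>x. imult (Z' i x - A' i x)"
  have bl: "bounded_linear (Z' i)" "bounded_linear (A' i)"
    using i clinear_Z' clinear_A' by (auto simp: clinear_op_def)
  have mem: "imult \<in> \<R>" "Z' i \<in> \<R>" "A' i \<in> \<R>" using i by (auto simp: \<R>_def)
  have lin: "linear R" if "R \<in> \<R>" for R using \<R>_bounded_linear[OF that] by (rule bounded_linear.linear)
  have linP: "linear P" and P_imult: "\<And>x. P (imult x) = imult (P x)"
    using clinear_P by (auto simp: clinear_op_def bounded_linear.linear)
  have inner_A': "inner (A' i x) y = inner x (Z' i y)" for x y
    using inner_Z'[OF i, of y x] by (simp add: inner_commute)
  have "\<exists>a. \<forall>x\<in>L. ?R x = a *\<^sub>R x"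
  proof (rule selfadjoint_commutant_scalar[OF irr])
    show "bounded_linear ?R" by (intro bounded_linear_add bl)
    show "inner (?R x) y = inner x (?R y)" for x y
      using i by (simp add: inner_add_left inner_add_right inner_Z' inner_A')
    show "P (?R x) = ?R (P x)" for x using i by (simp add: linear_add[OF linP] P_commute)
    show "R (?R x) = ?R (R x)" if "R \<in> \<R>" for R x
      using \<R>_commute[OF that mem(2), of x] \<R>_commute[OF that mem(3), of x]
      by (simp add: linear_add[OF lin[OF that]])
  qed
  then obtain a where a: "\<And>x. x \<in> L \<Longrightarrow> ?R x = a *\<^sub>R x" by blast
  have "\<exists>b. \<forall>x\<in>L. ?I x = b *\<^sub>R x"
  proof (rule selfadjoint_commutant_scalar[OF irr])
    show "bounded_linear ?I"
      by (intro bounded_linear_compose[OF bounded_linear_imult] bounded_linear_sub bl)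
    show "inner (?I x) y = inner x (?I y)" for x y
    proof -
      have "?I y = Z' i (imult y) - A' i (imult y)"
        using \<R>_commute[OF mem(1) mem(2), of y] \<R>_commute[OF mem(1) mem(3), of y]
        by (simp add: linear_diff[OF lin[OF mem(1)]])
      then show ?thesis
        using i by (simp add: inner_imult_left inner_diff_left inner_diff_right inner_Z' inner_A')
    qed
    show "P (?I x) = ?I (P x)" for x
      using i by (simp add: P_imult linear_diff[OF linP] P_commute)
    show "R (?I x) = ?I (R x)" if "R \<in> \<R>" for R x
      using \<R>_commute[OF that mem(2), of x] \<R>_commute[OF that mem(3), of x]
        \<R>_commute[OF that mem(1), of "Z' i x - A' i x"]
      by (simp add: linear_diff[OF lin[OF that]])
  qed
  then obtain b where b: "\<And>x. x \<in> L \<Longrightarrow> ?I x = b *\<^sub>R x" by blast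
  have "A i x = scaleC (cnj (Complex (a/2) (- b/2))) x \<and> Z i x = scaleC (Complex (a/2) (- b/2)) x"
    if x: "x \<in> L" for x
  proof -
    have "Z i x + A i x = a *\<^sub>R x" using a[OF x] x by (simp add: Z'_def A'_def P_id)
    moreover have "imult (Z i x - A i x) = b *\<^sub>R x" using b[OF x] x by (simp add: Z'_def A'_def P_id)
    then have "imult (imult (Z i x - A i x)) = b *\<^sub>R imult x" by (simp add: imult_scaleR)
    then have "A i x - Z i x = b *\<^sub>R imult x" by (simp add: imult_imult)
    moreover have "2 *\<^sub>R A i x = (Z i x + A i x) + (A i x - Z i x)"
      "2 *\<^sub>R Z i x = (Z i x + A i x) - (A i x - Z i x)" by (simp_all add: scaleR_2)
    ultimately have "2 *\<^sub>R A i x = a *\<^sub>R x + b *\<^sub>R imult x" "2 *\<^sub>R Z i x = a *\<^sub>R x - b *\<^sub>R imult x"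
      by (simp_all only:)
    then have "(1/2) *\<^sub>R (2 *\<^sub>R A i x) = (1/2) *\<^sub>R (a *\<^sub>R x + b *\<^sub>R imult x)"
      "(1/2) *\<^sub>R (2 *\<^sub>R Z i x) = (1/2) *\<^sub>R (a *\<^sub>R x - b *\<^sub>R imult x)" by simp_all
    then show ?thesis by (simp add: scaleC_def scaleR_add_right scaleR_diff_right)
  qed
  then show ?thesis by blast
qed

lemma cinner_W: "i < n \<Longrightarrow> cinner (W i x) y = cinner x (A i y)"
  using clinear_W[of i] by (simp add: cinner_def clinear_op_def inner_W[symmetric])

text \<open>All vectors of \<open>L\<close> are joint eigenvectors with the same eigenvalues, so the
  line through a unit vector of \<open>L\<close> is invariant and equals \<open>L\<close> by
  \<open>irreducible_L\<close>. This vector is cyclic because \<open>G L\<close> is a nonzero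
  reducing subspace, and the sphere condition is \<open>sum_inner_A\<close> at it.\<close>

theorem irreducible_comm_space:
  assumes irr: "irreducible_rep n W" and ne: "L \<noteq> {0}"
  shows "one_dim L \<and> (\<exists>w::nat \<Rightarrow> complex. (\<Sum>i<n. (cmod (w i))\<^sup>2) = 1 \<and> cuntz_gns_equiv n W w)"
proof -
  obtain w where w: "\<And>i x. i < n \<Longrightarrow> x \<in> L \<Longrightarrow> A i x = scaleC (cnj (w i)) x \<and> Z i x = scaleC (w i) x"
    using irreducible_eigenvalue[OF irr] by metis
  obtain v where v: "v \<in> L" "v \<noteq> 0" using ne subspace_0[OF subspace_L] by auto
  define \<xi> where "\<xi> = inverse (norm v) *\<^sub>R v"
  have \<xi>: "\<xi> \<in> L" "norm \<xi> = 1" using v by (simp_all add: \<xi>_def subspace_scale subspace_L)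
  then have "\<xi> \<noteq> 0" by auto
  let ?D = "range (\<lambda>c. scaleC c \<xi>)"
  have Lc: "csubspace L" using closed_csubspace_L by (simp add: closed_csubspace_def)
  have DL: "?D \<subseteq> L" using scaleC_in[OF Lc \<xi>(1)] by auto
  have sD: "scaleC c x \<in> ?D" if "x \<in> ?D" for c x using that by (auto simp: scaleC_scaleC)
  have "?D = {0} \<or> ?D = L"
  proof (rule irreducible_L[OF irr closed_csubspace_line[OF \<open>\<xi> \<noteq> 0\<close>] DL])
    show "A i x \<in> ?D" "Z i x \<in> ?D" if "i < n" "x \<in> ?D" for i x
      using w[OF that(1), of x] that(2) DL sD by auto
  qed
  moreover have "scaleC 1 \<xi> \<in> ?D" by blast
  then have "\<xi> \<in> ?D" by (simp add: scaleC_def)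
  ultimately have LD: "L = ?D" using \<open>\<xi> \<noteq> 0\<close> by auto
  have "one_dim L" unfolding one_dim_def using LD \<open>\<xi> \<noteq> 0\<close> by blast
  moreover have "(\<Sum>i<n. (cmod (w i))\<^sup>2) = 1"
  proof -
    have "(\<Sum>i<n. (cmod (w i))\<^sup>2) = (\<Sum>i<n. inner (A i \<xi>) (A i \<xi>))"
      by (rule sum.cong) (use w \<xi> in \<open>auto simp: power2_norm_eq_inner[symmetric] norm_scaleC\<close>)
    also have "\<dots> = 1" unfolding sum_inner_A using \<xi>(2) by (simp add: power2_norm_eq_inner[symmetric])
    finally show ?thesis .
  qed
  moreover have "cuntz_gns_equiv n W w"
    unfolding cuntz_gns_equiv_def
  proof (intro exI[of _ \<xi>] conjI allI impI)
    show "norm \<xi> = 1" by fact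
    let ?S = "{word W \<alpha> (word (\<lambda>i. A i) \<beta> \<xi>) | \<alpha> \<beta>. set \<alpha> \<subseteq> {..<n} \<and> set \<beta> \<subseteq> {..<n}}"
    have cS: "closed_csubspace (closure (cspan ?S))"
      by (intro closed_csubspace_closure csubspace_cspan)
    have "word W \<alpha> h \<in> closure (cspan ?S)" if \<alpha>: "set \<alpha> \<subseteq> {..<n}" and "h \<in> L" for \<alpha> h
    proof -
      obtain c where c: "h = scaleC c \<xi>" using \<open>h \<in> L\<close> LD by auto
      have "clinear_op (word W \<alpha>)" using \<alpha> by (intro clinear_op_word clinear_W) auto
      then have "word W \<alpha> h = scaleC c (word W \<alpha> \<xi>)" unfolding c by (rule clinear_op_scaleC)
      \<comment> \<open>Words with empty \<open>\<beta>\<close> already span a dense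
        subspace.\<close>
      moreover have "word W \<alpha> (word (\<lambda>i. A i) [] \<xi>) \<in> ?S" using \<alpha> by (intro CollectI exI[of _ \<alpha>] exI[of _ "[]"] conjI) auto
      from subsetD[OF closure_cspan_superset this] have "word W \<alpha> \<xi> \<in> closure (cspan ?S)" by simp
      ultimately show ?thesis using cS scaleC_in by (simp add: closed_csubspace_def)
    qed
    then have "G L \<subseteq> closure (cspan ?S)"
      unfolding G_def by (intro closure_cspan_least cS) auto
    moreover have "G L = UNIV"
    proof -
      have "reducing n W (G L)" using L_A by (rule reducing_G)
      moreover have "G L \<noteq> {0}" using G_superset[of L] v by blast
      ultimately show ?thesis using irr unfolding irreducible_rep_def by blast
    qed
    ultimately show "closure (cspan ?S) = UNIV" by auto
    fix \<alpha> \<beta> assume \<alpha>: "set \<alpha> \<subseteq> {..<n}" and \<beta>: "set \<beta> \<subseteq> {..<n}"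
    have A\<beta>: "word (\<lambda>i. A i) \<beta> \<xi> = scaleC (cnj (prod_list (map w \<beta>))) \<xi>"
      using \<beta>
    proof (induct \<beta>)
      case (Cons i \<beta>)
      then show ?case
        using w[of i \<xi>] \<xi>(1) clinear_op_scaleC[OF clinear_A[of i]] by (simp add: scaleC_scaleC mult.commute)
    qed (simp add: scaleC_def)
    \<comment> \<open>Each letter moves to the second slot as \<open>A i\<close>, where
      \<open>\<xi>\<close> has the eigenvalue \<open>cnj (w i)\<close>; conjugate linearity of that
      slot turns it back into \<open>w i\<close>.\<close>
    have W\<alpha>: "cinner (word W \<alpha> x) \<xi> = prod_list (map w \<alpha>) * cinner x \<xi>" for x
      using \<alpha>
    proof (induct \<alpha>)
      case (Cons i \<alpha>)
      then show ?case using w[of i \<xi>] \<xi>(1) by (simp add: cinner_W cinner_scaleC_right)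
    qed simp
    have "cinner \<xi> \<xi> = 1"
      using \<xi>(2) by (simp add: cinner_def complex_eq_iff power2_norm_eq_inner[symmetric])
    then show "cinner (word W \<alpha> (word (\<lambda>i. A i) \<beta> \<xi>)) \<xi>
        = prod_list (map w \<alpha>) * cnj (prod_list (map w \<beta>))"
      unfolding W\<alpha> A\<beta> cinner_scaleC_left by simp
  qed
  ultimately show ?thesis by blast
qed

end

theorem theorem19:
  fixes n :: nat and W :: "nat \<Rightarrow> 'h::chilbert \<Rightarrow> 'h"
  assumes "n \<ge> 2" and "cuntz_family n W"
  shows "(\<exists>!K0. reducing n W K0 \<and> reducing n W (orthogonal_comp K0) \<and>
              spherical n W K0 \<and> trivial_comm n W (orthogonal_comp K0))
       \<and> (comm_space n W UNIV = {0} \<or>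
            spherical_unitary_on n (comm_space n W UNIV) (max_comm_piece n W UNIV))
       \<and> (irreducible_rep n W \<longrightarrow>
            comm_space n W UNIV = {0} \<or>
            (one_dim (comm_space n W UNIV) \<and>
             (\<exists>w::nat \<Rightarrow> complex. (\<Sum>i<n. (cmod (w i))\<^sup>2) = 1 \<and> cuntz_gns_equiv n W w)))"
proof -
  interpret cuntz n W by (rule cuntz.intro) fact
  show ?thesis
    using unique_spherical_decomposition spherical_unitary_max_comm_piece irreducible_comm_space
    unfolding comm_space_UNIV by blast
qed

end
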